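(* Suppose that $(X,T)$ is a transitive dynamical system. (1) Given a subadditive sequence $\mathfrak{F}=\{f_n\}_{n=1}^{\infty}$ with $f_n\in C(X)$ for any $n$, if we denote $\mathfrak{F}_{\sup}^T=\sup_{x\in Trans(X,T)}\limsup_{n\to+\infty}\frac{1}{n}f_n(x)$, then $E_{\mathfrak{F}_{\sup}^T}=\{x\in Trans(X,T)\mid \limsup_{n\to+\infty}\frac{1}{n}f_n(x)=\mathfrak{F}_{\sup}^T \}$ is residual in $X$. (2) Given $A\in C(X,GL(d,\mathbb{R}))$, if we denote $A_{\sup}^T=\sup_{x\in Trans(X,T)}\overline{\chi}(x)$ and $A_{\inf}^T=\inf_{x\in Trans(X,T)}\underline{\chi}(x)$, then $E_{A_{\sup}^T}=\{x\in Trans(X,T)\mid \overline{\chi}(x)=A_{\sup}^T \}$ and $\tilde{E}_{A_{\inf}^T}=\{x\in Trans(X,T)\mid \underline{\chi}(x)=A_{\inf}^T \}$ are residual in $X$. Moreover, either $A_{\inf}^T=A_{\sup}^T$, or $LI_A$ is residual in $X$. (3) If further $\sharp \mathcal{M}_{Trans}>1$, then there exist a residual invariant subset $Y\subset X$ and a dense subset $\mathfrak{U}\subset C(X,GL(d,\mathbb{R}))$ such that for any $x\in Y$ and any $A\in \mathfrak{U}$ one has (a) $x\in Trans(X,T)$ and $V_T(x)=\mathcal{M}_{Trans}$; (b) $x\in LI_A$; (c) $V_T(x)\cap \mathcal{O}_{T}\neq\emptyset$ provided that $X=M$ is a manifold.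
   Context: $(X,d)$ is a compact metric space, $T:X\to X$ is continuous, and $(X,T)$ is called a dynamical system. It is transitive if for all nonempty open $U,V\subset X$ there is $n\in\mathbb{N}=\{0,1,2,\dots\}$ with $U\cap T^{-n}V\ne\emptyset$. $Trans(X,T)$ is the set of points whose forward orbit is dense in $X$. $C(X)$ is the space of real continuous functions on $X$ with the sup norm. A set is residual if it contains a dense $G_\delta$ subset. A sequence $\{f_n\}_{n\ge1}$ of functions $X\to\mathbb{R}$ is subadditive if $f_{m+n}(x)\le f_n(T^mx)+f_m(x)$ for all $x\in X$, $m,n\ge1$. $C(X,GL(d,\mathbb{R}))$ is the space of continuous maps from $X$ into the invertible $d\times d$ real matrices ($d\geq 1$ an integer), with the topology of $\|A\|=\sup_{x\in X}\|A(x)\|$; $A_n(x)=A(T^{n-1}x)\cdots A(Tx)A(x)$; $\overline{\chi}(x)=\limsup_{n\to\infty}\frac1n\log\|A_n(x)\|$, $\underline{\chi}(x)=\liminf_{n\to\infty}\frac1n\log\|A_n(x)\|$; $LI_A$ is the set of $x\in X$ for which $\lim_{n\to\infty}\frac1n\log\|A_n(x)\|$ diverges (the Lyapunov-irregular points). For $x\in X$, $V_T(x)$ is the set of weak* accumulation points of $\frac1n\sum_{i=0}^{n-1}\delta_{T^ix}$, and $\mathcal{M}_{Trans}=\bigcup_{y\in Trans(X,T)}V_T(y)$. Let $\rho(\mu_1,\mu_2)=\sum_{i\ge 1}2^{-i}|\int f_i d\mu_1-\int f_i d\mu_2|$ be a metric for the weak* topology on the space $\mathcal{M}(X)$ of Borel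 probability measures, where $\{f_i\}\subset C(X)$ is a suitable countable set with $\|f_i\|=1$. If $X=M$ is a manifold, $\mu\in\mathcal{M}(X)$ is physical-like if for every $\varepsilon>0$ the set $\{x\in X\mid\inf_{\nu\in V_T(x)}\rho(\mu,\nu)\le\varepsilon\}$ has positive Lebesgue measure; $\mathcal{O}_T$ denotes the set of physical-like measures of $T$. *)

theory Defs
  imports "HOL-Probability.Probability"
begin

text \<open>The compact metric space is a type \<open>'a :: metric_space\<close> with
  \<open>compact (UNIV :: 'a set)\<close>.  The type \<open>'a \<Rightarrow>\<^sub>C real\<close> of bounded continuous functions with
  the sup norm is then the whole space $C(X)$.\<close>

definition residual :: "'a::topological_space set \<Rightarrow> bool" where
  "residual S \<longleftrightarrow> (\<exists>G. G \<subseteq> S \<and> gdelta G \<and> closure G = UNIV)"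

definition transitive_system :: "('a::topological_space \<Rightarrow> 'a) \<Rightarrow> bool" where
  "transitive_system T \<longleftrightarrow>
    (\<forall>U V. open U \<and> U \<noteq> {} \<and> open V \<and> V \<noteq> {} \<longrightarrow> (\<exists>n. U \<inter> (T ^^ n) -` V \<noteq> {}))"

definition Trans :: "('a::topological_space \<Rightarrow> 'a) \<Rightarrow> 'a set" where
  "Trans T = {x. closure (range (\<lambda>n. (T ^^ n) x)) = UNIV}"


subsection \<open>Subadditive sequences\<close>

text \<open>Only the terms with index at least 1 matter; \<open>f 0\<close> is unconstrained.  Growth rates and
  their suprema are taken in \<^typ>\<open>ereal\<close>, since for a subadditive sequence they may be
  \<open>-\<infinity>\<close>.\<close>

definition subadditive_seq :: "('a::topological_space \<Rightarrow> 'a) \<Rightarrow> (nat \<Rightarrow> 'a \<Rightarrow>\<^sub>C real) \<Rightarrow> bool" where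
  "subadditive_seq T f \<longleftrightarrow>
    (\<forall>x. \<forall>m\<ge>1. \<forall>n\<ge>1. apply_bcontfun (f (m + n)) x
       \<le> apply_bcontfun (f n) ((T ^^ m) x) + apply_bcontfun (f m) x)"

definition growth :: "(nat \<Rightarrow> 'a::topological_space \<Rightarrow>\<^sub>C real) \<Rightarrow> 'a \<Rightarrow> ereal" where
  "growth f x = limsup (\<lambda>n. ereal (apply_bcontfun (f n) x / real n))"

definition growth_sup :: "('a::topological_space \<Rightarrow> 'a) \<Rightarrow> (nat \<Rightarrow> 'a \<Rightarrow>\<^sub>C real) \<Rightarrow> ereal" where
  "growth_sup T f = (SUP x\<in>Trans T. growth f x)"


subsection \<open>Matrix cocycles\<close>

abbreviation mat_norm :: "real^'d^'d \<Rightarrow> real" where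
  "mat_norm M \<equiv> onorm ((*v) M)"

definition C_GL :: "('a::topological_space \<Rightarrow> real^'d^'d) set" where
  "C_GL = {A. continuous_on UNIV A \<and> (\<forall>x. invertible (A x))}"

definition dense_in_C_GL :: "('a::topological_space \<Rightarrow> real^'d^'d) set \<Rightarrow> bool" where
  "dense_in_C_GL \<U> \<longleftrightarrow> \<U> \<subseteq> C_GL \<and>
    (\<forall>A\<in>C_GL. \<forall>\<epsilon>>0. \<exists>B\<in>\<U>. (SUP x. mat_norm (A x - B x)) < \<epsilon>)"

primrec cocycle :: "('a \<Rightarrow> 'a) \<Rightarrow> ('a \<Rightarrow> real^'d^'d) \<Rightarrow> nat \<Rightarrow> 'a \<Rightarrow> real^'d^'d" where
  "cocycle T A 0 x = mat 1"
| "cocycle T A (Suc n) x = A ((T ^^ n) x) ** cocycle T A n x"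

definition lyap_seq :: "('a \<Rightarrow> 'a) \<Rightarrow> ('a \<Rightarrow> real^'d^'d) \<Rightarrow> 'a \<Rightarrow> nat \<Rightarrow> real" where
  "lyap_seq T A x n = ln (mat_norm (cocycle T A n x)) / real n"

definition upper_lyap :: "('a \<Rightarrow> 'a) \<Rightarrow> ('a \<Rightarrow> real^'d^'d) \<Rightarrow> 'a \<Rightarrow> ereal" where
  "upper_lyap T A x = limsup (\<lambda>n. ereal (lyap_seq T A x n))"

definition lower_lyap :: "('a \<Rightarrow> 'a) \<Rightarrow> ('a \<Rightarrow> real^'d^'d) \<Rightarrow> 'a \<Rightarrow> ereal" where
  "lower_lyap T A x = liminf (\<lambda>n. ereal (lyap_seq T A x n))"

definition lyap_sup :: "('a::topological_space \<Rightarrow> 'a) \<Rightarrow> ('a \<Rightarrow> real^'d^'d) \<Rightarrow> ereal" where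
  "lyap_sup T A = (SUP x\<in>Trans T. upper_lyap T A x)"

definition lyap_inf :: "('a::topological_space \<Rightarrow> 'a) \<Rightarrow> ('a \<Rightarrow> real^'d^'d) \<Rightarrow> ereal" where
  "lyap_inf T A = (INF x\<in>Trans T. lower_lyap T A x)"

definition LI :: "('a \<Rightarrow> 'a) \<Rightarrow> ('a \<Rightarrow> real^'d^'d) \<Rightarrow> 'a set" where
  "LI T A = {x. \<not> convergent (lyap_seq T A x)}"


subsection \<open>Empirical measures and their weak* accumulation points\<close>

definition prob_measures :: "'a::topological_space measure set" where
  "prob_measures = {\<mu>. sets \<mu> = sets borel \<and> prob_space \<mu>}"

definition weak_star :: "'a::topological_space measure topology" where
  "weak_star = topology_generated_by
     {{\<mu> \<in> prob_measures. (LINT x|\<mu>. apply_bcontfun f x) \<in> U} | (f :: 'a \<Rightarrow>\<^sub>C real) U. open U}"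

definition empirical :: "('a::topological_space \<Rightarrow> 'a) \<Rightarrow> 'a \<Rightarrow> nat \<Rightarrow> 'a measure" where
  "empirical T x n = distr (uniform_count_measure {..<n}) borel (\<lambda>i. (T ^^ i) x)"

text \<open>The pushforward of the uniform distribution on $\{0,\dots,n-1\}$ is the average of the
  Dirac measures along the orbit.\<close>

lemma emeasure_empirical:
  assumes "n > 0" and B: "B \<in> sets borel"
  shows "emeasure (empirical T x n) B =
    ennreal ((\<Sum>i<n. measure (return borel ((T ^^ i) x)) B) / real n)"
proof -
  have "emeasure (empirical T x n) B =
      emeasure (uniform_count_measure {..<n}) ((\<lambda>i. (T ^^ i) x) -` B \<inter> {..<n})"
    unfolding empirical_def
    by (subst emeasure_distr) (use B in \<open>auto simp: space_uniform_count_measure measurable_def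
        sets_uniform_count_measure\<close>)
  also have "\<dots> = ennreal (real (card ((\<lambda>i. (T ^^ i) x) -` B \<inter> {..<n})) / real n)"
    by (subst emeasure_uniform_count_measure) (use assms in auto)
  also have "real (card ((\<lambda>i. (T ^^ i) x) -` B \<inter> {..<n})) =
      (\<Sum>i<n. measure (return borel ((T ^^ i) x)) B)"
  proof -
    have "(\<Sum>i<n. measure (return borel ((T ^^ i) x)) B) = (\<Sum>i<n. indicator B ((T ^^ i) x))"
      using B by (intro sum.cong) (auto simp: measure_return)
    also have "\<dots> = (\<Sum>i<n. indicator ((\<lambda>i. (T ^^ i) x) -` B) i)"
      by (intro sum.cong) (auto simp: indicator_def)
    also have "\<dots> = real (card ((\<lambda>i. (T ^^ i) x) -` B \<inter> {..<n}))"
      by (simp add: indicator_def of_bool_def sum.If_cases Int_commute vimage_def)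
    finally show ?thesis by simp
  qed
  finally show ?thesis .
qed

definition limit_measures :: "('a::topological_space \<Rightarrow> 'a) \<Rightarrow> 'a \<Rightarrow> 'a measure set" where
  "limit_measures T x = {\<mu> \<in> prob_measures. \<forall>W. openin weak_star W \<and> \<mu> \<in> W \<longrightarrow>
     (\<exists>\<^sub>F n in sequentially. empirical T x n \<in> W)}"

definition M_Trans :: "('a::topological_space \<Rightarrow> 'a) \<Rightarrow> 'a measure set" where
  "M_Trans T = (\<Union>y\<in>Trans T. limit_measures T y)"

text \<open>The family is indexed from 0, so \<open>F i\<close> carries the weight \<open>2 ^ -(i + 1)\<close>.\<close>

definition rho :: "(nat \<Rightarrow> 'a::topological_space \<Rightarrow>\<^sub>C real) \<Rightarrow> 'a measure \<Rightarrow> 'a measure \<Rightarrow> real" where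
  "rho F \<mu> \<nu> = (\<Sum>i. (1/2) ^ Suc i *
     \<bar>(LINT x|\<mu>. apply_bcontfun (F i) x) - (LINT x|\<nu>. apply_bcontfun (F i) x)\<bar>)"

text \<open>The family is normalized and \<open>rho F\<close> induces the weak* topology on the probability
  measures.  The metric axioms follow: \<open>rho F\<close> is always a pseudometric there, and the weak*
  topology of a metric space is Hausdorff.\<close>

definition metrizing_family :: "(nat \<Rightarrow> 'a::topological_space \<Rightarrow>\<^sub>C real) \<Rightarrow> bool" where
  "metrizing_family F \<longleftrightarrow> (\<forall>i. norm (F i) = 1) \<and>
    (\<forall>W \<subseteq> prob_measures. openin weak_star W \<longleftrightarrow>
       (\<forall>\<mu>\<in>W. \<exists>r>0. \<forall>\<nu>\<in>prob_measures. rho F \<mu> \<nu> < r \<longrightarrow> \<nu> \<in> W))"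


subsection \<open>Manifolds, Lebesgue measure and physical-like measures\<close>

text \<open>A manifold structure is given by an atlas of charts \<open>(U, \<phi>)\<close> with values in a
  Euclidean space.  Class \<open>C\<^sup>1\<close> of the transition maps is all that Lebesgue measure needs, and
  every smooth atlas is of this kind.  Lebesgue measure on the manifold is a measure that has a
  positive continuous density with respect to \<^const>\<open>lborel\<close> in each chart, as the volume of a
  Riemannian metric does; all of them have the same sets of positive measure.\<close>

definition C1_map_on :: "'m::euclidean_space set \<Rightarrow> ('m \<Rightarrow> 'm) \<Rightarrow> bool" where
  "C1_map_on S g \<longleftrightarrow> (\<exists>g' :: 'm \<Rightarrow> 'm \<Rightarrow>\<^sub>L 'm.
     (\<forall>y\<in>S. (g has_derivative blinfun_apply (g' y)) (at y)) \<and> continuous_on S g')"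

definition C1_atlas :: "('a::topological_space set \<times> ('a \<Rightarrow> 'm::euclidean_space)) set \<Rightarrow> bool" where
  "C1_atlas \<A> \<longleftrightarrow>
    (\<forall>(U, \<phi>)\<in>\<A>. open U \<and> open (\<phi> ` U) \<and> homeomorphism U (\<phi> ` U) \<phi> (inv_into U \<phi>)) \<and>
    (\<Union>(U, \<phi>)\<in>\<A>. U) = UNIV \<and>
    (\<forall>(U, \<phi>)\<in>\<A>. \<forall>(U', \<psi>)\<in>\<A>. C1_map_on (\<phi> ` (U \<inter> U')) (\<psi> \<circ> inv_into U \<phi>))"

definition lebesgue_on_manifold ::
  "('a::topological_space set \<times> ('a \<Rightarrow> 'm::euclidean_space)) set \<Rightarrow> 'a measure \<Rightarrow> bool" where
  "lebesgue_on_manifold \<A> m \<longleftrightarrow> sets m = sets borel \<and>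
    (\<forall>(U, \<phi>)\<in>\<A>. \<exists>w :: 'm \<Rightarrow> real.
       continuous_on (\<phi> ` U) w \<and> (\<forall>y\<in>\<phi> ` U. 0 < w y) \<and>
       (\<forall>B\<in>sets borel. B \<subseteq> U \<longrightarrow>
          emeasure m B = (\<integral>\<^sup>+y. ennreal (w y) * indicator (\<phi> ` B) y \<partial>lborel)))"

text \<open>On a compact space \<open>limit_measures T x\<close> is nonempty and the sets measured here are Borel: the infimum
  is the lower limit of the distances from \<open>\<mu>\<close> to the empirical measures.\<close>

definition physical_like :: "('a::topological_space \<Rightarrow> 'a) \<Rightarrow> (nat \<Rightarrow> 'a \<Rightarrow>\<^sub>C real) \<Rightarrow>
    'a measure \<Rightarrow> 'a measure set" where
  "physical_like T F m = {\<mu> \<in> prob_measures.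
     \<forall>\<epsilon>>0. emeasure m {x. (INF \<nu>\<in>limit_measures T x. rho F \<mu> \<nu>) \<le> \<epsilon>} > 0}"

end

theory Submission
  imports Defs
begin

text \<open>
  Everything rests on one mechanism. Let \<open>G n\<close> be open sets and suppose that a dense set of points
  lies in \<open>G n\<close> for infinitely many \<open>n\<close>. Then \<open>\<Inter>N. \<Union>n\<ge>N. G n\<close> is an intersection of dense open
  sets, so by Baire a generic point lies in infinitely many \<open>G n\<close> (\<open>residual_frequently_open\<close>).
  In a transitive system the dense set is an orbit: a property of the asymptotic behaviour of one
  transitive point \<open>y\<close> which passes from \<open>y\<close> to \<open>T y\<close> holds along the whole dense orbit of \<open>y\<close>,
  hence generically.

  For a subadditive sequence the upper growth rate does not decrease along orbits, because
  \<open>f (n+1) x \<le> f n (T x) + f 1 x\<close>. So every rate below the supremum is exceeded generically, and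
  countably many rates exhaust the supremum (\<open>residual_limsup_eq_SUP\<close>). The logarithms of the norms
  of a matrix cocycle are subadditive, which gives the upper exponent; for the lower exponent the
  opposite inequality is needed, and it holds with the constant \<open>ln \<parallel>A(x)\<^sup>-\<^sup>1\<parallel>\<close> since the matrices
  are invertible. If the two extremal values differ, a generic point attains both and is irregular.

  For empirical measures the open sets are the preimages of the members of a countable base of the
  weak* topology. A limit measure of a transitive point \<open>y\<close> is a limit measure of every iterate of
  \<open>y\<close>, so a generic point has all of \<^term>\<open>M_Trans T\<close> as its set of limit measures
  (\<open>residual_limit_measures_eq_M_Trans\<close>). The topology is handled through the moments with respect to
  a uniformly dense sequence of test functions, that is, in the metrizable space of real sequences.
  Limit measures exist by compactness of the space of probability measures
  (\<open>prob_measures_seq_compact\<close>), which is obtained by coding \<open>X\<close> into the real line and applying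
  Helly's selection theorem there.

  Irregularity for a dense set of cocycles: if \<open>LI T A\<close> is not residual, then the exponent of \<open>A\<close>
  exists and is the same at all transitive points. Multiplying \<open>A\<close> by \<open>exp (t \<phi>)\<close> adds \<open>t\<close> times
  the Birkhoff averages of \<open>\<phi>\<close> to the exponents, and these diverge at a generic point when \<open>\<phi>\<close> has
  different integrals against two measures in \<^term>\<open>M_Trans T\<close>. So the cocycles with a residual
  irregular set are dense. The space of cocycles is separable, so countably many of them are
  already dense, and their irregular sets have a residual intersection.

  Physical-like measures: a measure that is not physical-like has a weak* neighbourhood in which
  Lebesgue-almost every \<open>z\<close> has no limit measure. If this were the case for all measures in
  \<^term>\<open>M_Trans T\<close>, then almost every \<open>z\<close> would have a limit measure outside an open set \<open>N\<close> that
  contains \<^term>\<open>M_Trans T\<close>. A set of full Lebesgue measure is dense, so by the mechanism above a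
  generic point would have a limit measure outside \<open>N\<close> too, although its limit measures are those
  in \<^term>\<open>M_Trans T\<close> (\<open>M_Trans_meets_physical_like\<close>).
\<close>

section \<open>Residual sets in compact metric spaces\<close>

lemma residual_mono: "residual S \<Longrightarrow> S \<subseteq> S' \<Longrightarrow> residual S'"
  unfolding residual_def by blast

text \<open>Baire's theorem applies because a compact Hausdorff space is locally compact and regular.\<close>

lemma residual_INT_open_dense:
  fixes G :: "nat \<Rightarrow> 'a::metric_space set"
  assumes cpt: "compact (UNIV :: 'a set)"
    and G: "\<And>n. open (G n)" "\<And>n. closure (G n) = UNIV"
  shows "residual (\<Inter>n. G n)"
proof -
  have "compact_space (euclidean :: 'a topology)"
    using cpt by (simp add: compact_space_def)
  then have "locally_compact_space (euclidean :: 'a topology) \<and> regular_space (euclidean :: 'a topology)"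
    by (simp add: compact_Hausdorff_imp_regular_space compact_imp_locally_compact_space)
  then have "euclidean closure_of (\<Inter>(range G)) = topspace (euclidean :: 'a topology)"
    using G by (intro Baire_category) auto
  then have "closure (\<Inter>n. G n) = UNIV" by simp
  moreover have "gdelta (\<Inter>n. G n)"
    using gdelta.intros[of G] G by simp
  ultimately show ?thesis unfolding residual_def by blast
qed

text \<open>Each set contains an intersection of open sets that are dense because their intersection is, and
the doubly indexed family of all these open sets can be listed as one sequence.\<close>

lemma residual_INT:
  fixes S :: "nat \<Rightarrow> 'a::metric_space set"
  assumes cpt: "compact (UNIV :: 'a set)" and S: "\<And>n. residual (S n)"
  shows "residual (\<Inter>n. S n)"
proof -
  have "\<exists>F :: nat \<Rightarrow> 'a set. (\<forall>k. open (F k) \<and> closure (F k) = UNIV) \<and> (\<Inter>k. F k) \<subseteq> S n" for n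
  proof -
    obtain G where G: "G \<subseteq> S n" "gdelta G" "closure G = UNIV"
      using S[of n] unfolding residual_def by blast
    obtain F :: "nat \<Rightarrow> 'a set" where F: "\<And>k. open (F k)" "G = (\<Inter>k. F k)"
      using G(2) by (auto elim: gdelta.cases)
    have "closure (F k) = UNIV" for k
      using G(3) closure_mono[of G "F k"] F(2) by auto
    then show ?thesis using F G(1) by blast
  qed
  then obtain F :: "nat \<Rightarrow> nat \<Rightarrow> 'a set"
    where F: "\<And>n k. open (F n k)" "\<And>n k. closure (F n k) = UNIV" "\<And>n. (\<Inter>k. F n k) \<subseteq> S n"
    by metis
  have "residual (\<Inter>m. F (fst (prod_decode m)) (snd (prod_decode m)))"
    by (intro residual_INT_open_dense cpt F)
  moreover have "x \<in> S n" if "x \<in> (\<Inter>m. F (fst (prod_decode m)) (snd (prod_decode m)))" for x n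
  proof -
    have "x \<in> F n k" for k
      using that[THEN INT_D[where a = "prod_encode (n, k)"]] by simp
    then show ?thesis using F(3)[of n] by blast
  qed
  ultimately show ?thesis by (elim residual_mono) blast
qed

lemma residual_UNIV: "residual UNIV"
  unfolding residual_def using gdelta.intros[of "\<lambda>_. UNIV"] by auto

lemma residual_INT_countable:
  fixes S :: "'i \<Rightarrow> 'a::metric_space set"
  assumes cpt: "compact (UNIV :: 'a set)" and I: "countable I"
    and S: "\<And>i. i \<in> I \<Longrightarrow> residual (S i)"
  shows "residual (\<Inter>i\<in>I. S i)"
proof (cases "I = {}")
  case False
  have "residual (\<Inter>n. S (from_nat_into I n))"
    by (intro residual_INT cpt S from_nat_into False)
  moreover have "(\<Inter>n. S (from_nat_into I n)) = (\<Inter>i\<in>I. S i)"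
    using range_from_nat_into[OF False I] by (metis image_image)
  ultimately show ?thesis by simp
qed (simp add: residual_UNIV)

lemma residual_Int:
  fixes S S' :: "'a::metric_space set"
  assumes "compact (UNIV :: 'a set)" "residual S" "residual S'"
  shows "residual (S \<inter> S')"
  using residual_INT_countable[of UNIV "\<lambda>b. if b then S else S'"] assms
  by (simp add: UNIV_bool Int_commute)

lemma residual_nonempty: "residual S \<Longrightarrow> S \<noteq> {}"
  unfolding residual_def by fastforce

text \<open>The passage from a dense set to a generic point: visiting \<open>G n\<close> infinitely often means lying in
all the tail unions of the \<open>G n\<close>, and these are open, and dense as soon as the points with
infinitely many visits are.\<close>

lemma residual_frequently_open:
  fixes G :: "nat \<Rightarrow> 'a::metric_space set"
  assumes cpt: "compact (UNIV :: 'a set)" and G: "\<And>n. open (G n)"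
    and dense: "\<And>U. open U \<Longrightarrow> U \<noteq> {} \<Longrightarrow> \<exists>z\<in>U. \<exists>\<^sub>F n in sequentially. z \<in> G n"
  shows "residual {x. \<exists>\<^sub>F n in sequentially. x \<in> G n}"
proof -
  have "closure (\<Union>n\<in>{N..}. G n) = UNIV" for N
  proof -
    have "(\<Union>n\<in>{N..}. G n) \<inter> U \<noteq> {}" if U: "open U" "U \<noteq> {}" for U
    proof -
      obtain z where z: "z \<in> U" "\<exists>\<^sub>F n in sequentially. z \<in> G n" using dense[OF U] by blast
      then obtain n where "n \<ge> N" "z \<in> G n" unfolding frequently_sequentially by blast
      then show ?thesis using z(1) by blast
    qed
    then show ?thesis
      using dense_intersects_open[of euclidean "\<Union>n\<in>{N..}. G n"] by simp
  qed
  then have "residual (\<Inter>N. \<Union>n\<in>{N..}. G n)"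
    using G by (intro residual_INT_open_dense cpt) auto
  also have "(\<Inter>N. \<Union>n\<in>{N..}. G n) = {x. \<exists>\<^sub>F n in sequentially. x \<in> G n}"
    unfolding frequently_sequentially by auto
  finally show ?thesis .
qed

text \<open>A compact metric space is totally bounded; the nets for the radii \<open>1 / (n + 1)\<close> are listed as one
sequence of balls. This sequence plays the role of a countable base, of a net for approximating
continuous functions, and of the digits in a coding of the space by real numbers.\<close>

lemma compact_ball_sequence:
  assumes cpt: "compact (UNIV :: 'a::metric_space set)"
  obtains c :: "nat \<Rightarrow> 'a::metric_space" and r :: "nat \<Rightarrow> real"
  where "\<And>i. 0 < r i"
    and "\<And>e. 0 < e \<Longrightarrow> \<exists>N. \<forall>x. \<exists>i<N. dist (c i) x < r i \<and> r i < e"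
proof -
  have "\<exists>K. finite K \<and> (UNIV :: 'a set) \<subseteq> (\<Union>x\<in>K. ball x (inverse (real (Suc n))))" for n
  proof -
    have "0 < inverse (real (Suc n))" by simp
    from seq_compact_imp_totally_bounded[OF compact_imp_seq_compact[OF cpt], rule_format, OF this]
    show ?thesis by (elim exE conjE) (intro exI conjI)
  qed
  then obtain K :: "nat \<Rightarrow> 'a set"
    where K: "\<And>n. finite (K n)" "\<And>n. (UNIV :: 'a set) \<subseteq> (\<Union>x\<in>K n. ball x (inverse (real (Suc n))))"
    by metis
  define P where "P = (\<Union>n. K n \<times> {inverse (real (Suc n))})"
  have "countable P" unfolding P_def using K(1) by (auto intro: countable_finite)
  have "K 0 \<noteq> {}" using K(2)[of 0] by auto
  then have "P \<noteq> {}" unfolding P_def by blast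
  define p where "p = from_nat_into P"
  have p: "range p = P" unfolding p_def by (rule range_from_nat_into) fact+
  have pos: "0 < snd (p i)" for i
  proof -
    have "p i \<in> P" using p by blast
    then show ?thesis unfolding P_def by auto
  qed
  have "\<exists>N. \<forall>x. \<exists>i<N. dist (fst (p i)) x < snd (p i) \<and> snd (p i) < e" if "0 < e" for e
  proof -
    obtain n where n: "inverse (real (Suc n)) < e" using reals_Archimedean[OF \<open>0 < e\<close>] by blast
    have "\<forall>y\<in>K n. \<exists>i. p i = (y, inverse (real (Suc n)))"
    proof
      fix y assume "y \<in> K n"
      then have "(y, inverse (real (Suc n))) \<in> range p" unfolding p P_def by blast
      then show "\<exists>i. p i = (y, inverse (real (Suc n)))" by (metis rangeE)
    qed
    then obtain j where j: "\<And>y. y \<in> K n \<Longrightarrow> p (j y) = (y, inverse (real (Suc n)))" by metis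
    obtain N where N: "\<forall>i\<in>j ` K n. i < N"
      using finite_nat_set_iff_bounded[of "j ` K n"] K(1) by blast
    show ?thesis
    proof (rule exI[of _ N], rule allI)
      fix x
      obtain y where "y \<in> K n" "dist y x < inverse (real (Suc n))"
        using subsetD[OF K(2)[of n] UNIV_I[of x]] by (auto simp del: of_nat_Suc)
      then have "j y < N \<and> dist (fst (p (j y))) x < snd (p (j y)) \<and> snd (p (j y)) < e"
        using N j[of y] n by auto
      then show "\<exists>i<N. dist (fst (p i)) x < snd (p i) \<and> snd (p i) < e" by blast
    qed
  qed
  then show thesis by (intro that[of "\<lambda>i. snd (p i)" "\<lambda>i. fst (p i)"] pos)
qed

section \<open>Transitive points\<close>

lemma continuous_on_funpow:
  fixes T :: "'a::topological_space \<Rightarrow> 'a"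
  assumes "continuous_on UNIV T"
  shows "continuous_on UNIV (T ^^ n)"
proof (induction n)
  case (Suc n)
  then show ?case
    using assms continuous_on_compose[of UNIV "T ^^ n" T] continuous_on_subset by (simp add: o_def) blast
qed (simp add: id_def)

lemma Trans_iff: "x \<in> Trans T \<longleftrightarrow> (\<forall>U. open U \<and> U \<noteq> {} \<longrightarrow> (\<exists>n. (T ^^ n) x \<in> U))"
proof -
  have "x \<in> Trans T \<longleftrightarrow> (\<forall>U. open U \<and> U \<noteq> {} \<longrightarrow> U \<inter> range (\<lambda>n. (T ^^ n) x) \<noteq> {})"
    unfolding Trans_def mem_Collect_eq
    using dense_intersects_open[of euclidean "range (\<lambda>n. (T ^^ n) x)"] by (simp add: Int_commute)
  then show ?thesis by blast
qed

lemma transitive_systemD: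
  assumes "transitive_system T" "open U" "U \<noteq> {}" "open V" "V \<noteq> {}"
  shows "\<exists>n. U \<inter> (T ^^ n) -` V \<noteq> {}"
  using assms(1)[unfolded transitive_system_def, rule_format, of U V] assms(2-) by simp

text \<open>An orbit is dense once it visits every ball of the sequence, and by transitivity the points that
visit a given ball form a dense open set.\<close>

lemma residual_Trans:
  fixes T :: "'a::metric_space \<Rightarrow> 'a"
  assumes cpt: "compact (UNIV :: 'a set)" and T: "continuous_on UNIV T" and tr: "transitive_system T"
  shows "residual (Trans T)"
proof -
  obtain c :: "nat \<Rightarrow> 'a" and r :: "nat \<Rightarrow> real" where r: "\<And>i. 0 < r i"
    and cr: "\<And>e. 0 < e \<Longrightarrow> \<exists>N. \<forall>x. \<exists>i<N. dist (c i) x < r i \<and> r i < e"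
    using compact_ball_sequence[OF cpt] by metis
  define G where "G i = (\<Union>n. (T ^^ n) -` ball (c i) (r i))" for i
  have "open (G i)" for i
    unfolding G_def using continuous_on_funpow[OF T]
    by (auto intro!: open_vimage)
  moreover have "closure (G i) = UNIV" for i
  proof -
    have "G i \<inter> U \<noteq> {}" if U: "open U" "U \<noteq> {}" for U
    proof -
      have "ball (c i) (r i) \<noteq> {}" using r[of i] by simp
      from transitive_systemD[OF tr U open_ball this]
      obtain n x where "x \<in> U" "(T ^^ n) x \<in> ball (c i) (r i)" by auto
      then show ?thesis unfolding G_def by blast
    qed
    then show ?thesis
      using dense_intersects_open[of euclidean "G i"] by simp
  qed
  ultimately have "residual (\<Inter>i. G i)" by (intro residual_INT_open_dense cpt)
  moreover have "(\<Inter>i. G i) \<subseteq> Trans T"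
  proof
    fix x assume x: "x \<in> (\<Inter>i. G i)"
    show "x \<in> Trans T" unfolding Trans_iff
    proof (intro allI impI, elim conjE)
      fix U :: "'a set" assume "open U" "U \<noteq> {}"
      then obtain y e where y: "y \<in> U" "0 < e" "ball y e \<subseteq> U"
        by (meson ex_in_conv open_contains_ball)
      obtain i where i: "dist (c i) y < r i" "r i < e / 2" using cr[of "e / 2"] y(2) by auto
      obtain n where "(T ^^ n) x \<in> ball (c i) (r i)" using x unfolding G_def by blast
      then have "dist y ((T ^^ n) x) < e"
        using i dist_triangle[of y "(T ^^ n) x" "c i"] by (simp add: dist_commute)
      then show "\<exists>n. (T ^^ n) x \<in> U" using y(3) by auto
    qed
  qed
  ultimately show ?thesis by (rule residual_mono)
qed

lemma Trans_backward:
  assumes "T x \<in> Trans T"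
  shows "x \<in> Trans T"
  using assms unfolding Trans_iff by (metis comp_apply funpow_Suc_right)

text \<open>Dropping the initial point of a dense orbit could only lose that point, which would then be
isolated. Transitivity rules this out: some point of the remaining orbit closure would have to
return to it.\<close>

lemma Trans_forward:
  fixes T :: "'a::metric_space \<Rightarrow> 'a"
  assumes T: "continuous_on UNIV T" and tr: "transitive_system T" and x: "x \<in> Trans T"
  shows "T x \<in> Trans T"
proof -
  define C where "C = closure (range (\<lambda>n. (T ^^ n) (T x)))"
  have *: "(T ^^ Suc n) x \<in> C" for n
    unfolding C_def funpow_Suc_right o_def by (intro subsetD[OF closure_subset]) blast
  have "y \<in> insert x C" for y
  proof (rule ccontr)
    assume "y \<notin> insert x C"
    then have "open (- insert x C)" "- insert x C \<noteq> {}"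
      unfolding C_def by (auto intro: open_Compl)
    then obtain n where "(T ^^ n) x \<in> - insert x C" using x unfolding Trans_iff by blast
    then show False using * by (cases n) auto
  qed
  then have all: "insert x C = UNIV" by blast
  have "x \<in> C"
  proof (rule ccontr)
    assume "x \<notin> C"
    \<comment> \<open>Both \<open>C\<close> and \<open>{x}\<close> are open, but an orbit that starts in the closure of the orbit of \<open>T x\<close>
      does not reach the isolated point \<open>x\<close>.\<close>
    then have C: "C = - {x}" using all by blast
    then have "open C" by auto
    moreover have "C \<noteq> {}" using *[of 0] by blast
    moreover have "open {x}"
      using C unfolding C_def by (metis closed_closure double_complement open_Compl)
    ultimately obtain n where "C \<inter> (T ^^ n) -` {x} \<noteq> {}"
      using transitive_systemD[OF tr, of C "{x}"] by auto
    moreover have "C \<inter> (T ^^ n) -` {x} = {}"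
    proof (rule ccontr)
      assume "C \<inter> (T ^^ n) -` {x} \<noteq> {}"
      moreover have "open ((T ^^ n) -` {x})"
        using continuous_on_funpow[OF T] \<open>open {x}\<close> by (auto intro!: open_vimage)
      ultimately have "range (\<lambda>k. (T ^^ k) (T x)) \<inter> (T ^^ n) -` {x} \<noteq> {}"
        unfolding C_def using open_Int_closure_eq_empty by blast
      then obtain k where "(T ^^ n) ((T ^^ k) (T x)) = x" by blast
      then have "(T ^^ Suc (n + k)) x = x" by (simp add: funpow_add funpow_swap1)
      then show False using *[of "n + k"] \<open>x \<notin> C\<close> by simp
    qed
    ultimately show False by blast
  qed
  then have "C = UNIV" using all by (simp add: insert_absorb)
  then show ?thesis unfolding Trans_def C_def by blast
qed

section \<open>Growth rates along an orbit\<close>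

lemma limsup_gt_frequently:
  fixes v :: "nat \<Rightarrow> ereal"
  assumes "a < limsup v"
  shows "\<exists>\<^sub>F n in sequentially. a < v n"
proof (rule ccontr)
  assume "\<not> ?thesis"
  then have "limsup v \<le> a" by (intro Limsup_bounded) (simp add: not_frequently not_less)
  then show False using assms by simp
qed

lemma frequently_le_limsup:
  fixes v :: "nat \<Rightarrow> ereal"
  assumes "\<exists>\<^sub>F n in sequentially. a \<le> v n"
  shows "a \<le> limsup v"
proof (rule ccontr)
  assume "\<not> ?thesis"
  then have "limsup v < a" by simp
  from Limsup_lessD[OF this] have "\<forall>\<^sub>F n in sequentially. v n < a" .
  then show False using assms by (simp add: frequently_def not_le)
qed

text \<open>The shift of the index and the additive constant disappear after division by \<open>n\<close>. The averages
may be unbounded below, so the argument compares levels: if \<open>u n / n\<close> exceeds \<open>b\<close> infinitely often,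
then \<open>v n / n\<close> exceeds any \<open>a < b\<close> infinitely often.\<close>

lemma limsup_average_mono_shift:
  fixes u v :: "nat \<Rightarrow> real"
  assumes uv: "\<And>n. n \<ge> 1 \<Longrightarrow> u (Suc n) \<le> v n + c"
  shows "limsup (\<lambda>n. ereal (u n / real n)) \<le> limsup (\<lambda>n. ereal (v n / real n))"
proof (rule dense_le)
  fix y :: ereal assume y: "y < limsup (\<lambda>n. ereal (u n / real n))"
  obtain b' where "y < b'" "b' < limsup (\<lambda>n. ereal (u n / real n))" using dense[OF y] by blast
  moreover obtain a where a: "y < ereal a" "ereal a < b'" using ereal_dense2[OF \<open>y < b'\<close>] by blast
  ultimately obtain b where b: "a < b" "ereal b < limsup (\<lambda>n. ereal (u n / real n))"
    using ereal_dense2[of "ereal a" b'] by (auto dest: less_trans)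
  have freq: "\<exists>\<^sub>F n in sequentially. b < u n / real n"
    using limsup_gt_frequently[OF b(2)] by simp
  \<comment> \<open>From index \<open>M\<close> on, the gap \<open>n (b - a)\<close> absorbs the constant \<open>c\<close> and the one extra step.\<close>
  obtain M :: nat where M: "real M * (b - a) > \<bar>c\<bar> + \<bar>b\<bar>"
    using reals_Archimedean3[of "b - a"] b(1) by fastforce
  have "\<exists>n\<ge>N. a < v n / real n" for N
  proof -
    obtain m where m: "m \<ge> N + M + 2" "b < u m / real m"
      using freq unfolding frequently_sequentially by blast
    define n where "n = m - 1"
    have n: "m = Suc n" "n \<ge> N" "n \<ge> M" "n \<ge> 1" using m unfolding n_def by auto
    have "b * real m < u m" using m by (simp add: pos_less_divide_eq)
    also have "\<dots> \<le> v n + c" using uv[of n] n by simp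
    finally have "b * (real n + 1) < v n + c" using n by (simp add: add.commute)
    moreover have "real M * (b - a) \<le> real n * (b - a)" using n b(1) by (simp add: mult_right_mono)
    ultimately have "a * real n < v n" using M by (simp add: algebra_simps)
    then show ?thesis using n by (intro exI[of _ n]) (simp add: pos_less_divide_eq)
  qed
  then have "\<exists>\<^sub>F n in sequentially. a < v n / real n" unfolding frequently_sequentially by blast
  then have "ereal a \<le> limsup (\<lambda>n. ereal (v n / real n))"
    by (intro frequently_le_limsup) (auto elim: frequently_elim1)
  then show "y \<le> limsup (\<lambda>n. ereal (v n / real n))" using a(1) by simp
qed

lemma liminf_average_mono_shift:
  fixes u v :: "nat \<Rightarrow> real"
  assumes uv: "\<And>n. n \<ge> 1 \<Longrightarrow> v n \<le> u (Suc n) + c"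
  shows "liminf (\<lambda>n. ereal (v n / real n)) \<le> liminf (\<lambda>n. ereal (u n / real n))"
proof -
  have "limsup (\<lambda>n. ereal (- u n / real n)) \<le> limsup (\<lambda>n. ereal (- v n / real n))"
    by (rule limsup_average_mono_shift[of "\<lambda>n. - u n" "\<lambda>n. - v n" c]) (use uv in force)
  moreover have "limsup (\<lambda>n. ereal (- w n / real n)) = - liminf (\<lambda>n. ereal (w n / real n))"
    for w :: "nat \<Rightarrow> real"
    using ereal_Limsup_uminus[of sequentially "\<lambda>n. ereal (w n / real n)"] by simp
  ultimately show ?thesis by simp
qed

text \<open>For a two-sided bound on the difference the ordinary limits agree as well; this makes the set of
irregular points completely invariant.\<close>

lemma average_shift_tendsto_iff:
  fixes u v :: "nat \<Rightarrow> real"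
  assumes uv: "\<And>n. \<bar>u (Suc n) - v n\<bar> \<le> c"
  shows "(\<lambda>n. v n / real n) \<longlonglongrightarrow> L \<longleftrightarrow> (\<lambda>n. u n / real n) \<longlonglongrightarrow> L"
proof -
  have d: "(\<lambda>n. (u (Suc n) - v n) / real (Suc n)) \<longlonglongrightarrow> 0"
  proof (rule tendsto_rabs_zero_cancel,
      rule tendsto_sandwich[where f = "\<lambda>_. 0" and h = "\<lambda>n. c / real (Suc n)"])
    show "(\<lambda>n. c / real (Suc n)) \<longlonglongrightarrow> 0"
      using tendsto_mult_right_zero[OF LIMSEQ_inverse_real_of_nat, of c] by (simp add: divide_inverse)
  qed (use uv in \<open>auto simp: abs_divide divide_right_mono intro!: always_eventually\<close>)
  have r: "(\<lambda>n. real n / real (Suc n)) \<longlonglongrightarrow> 1" by (rule LIMSEQ_n_over_Suc_n)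
  have r': "(\<lambda>n. real (Suc n) / real n) \<longlonglongrightarrow> 1" by (rule LIMSEQ_Suc_n_over_n)
  have "(\<lambda>n. u n / real n) \<longlonglongrightarrow> L \<longleftrightarrow> (\<lambda>n. u (Suc n) / real (Suc n)) \<longlonglongrightarrow> L"
    by (rule filterlim_sequentially_Suc[symmetric])
  also have "\<dots> \<longleftrightarrow> (\<lambda>n. v n / real (Suc n)) \<longlonglongrightarrow> L"
  proof
    assume "(\<lambda>n. u (Suc n) / real (Suc n)) \<longlonglongrightarrow> L"
    from tendsto_diff[OF this d] show "(\<lambda>n. v n / real (Suc n)) \<longlonglongrightarrow> L"
      by (simp add: diff_divide_distrib[symmetric])
  next
    assume "(\<lambda>n. v n / real (Suc n)) \<longlonglongrightarrow> L"
    from tendsto_add[OF this d] show "(\<lambda>n. u (Suc n) / real (Suc n)) \<longlonglongrightarrow> L"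
      by (simp add: add_divide_distrib[symmetric])
  qed
  also have "\<dots> \<longleftrightarrow> (\<lambda>n. v n / real n) \<longlonglongrightarrow> L"
  proof
    assume "(\<lambda>n. v n / real (Suc n)) \<longlonglongrightarrow> L"
    from tendsto_mult[OF this r'] have "(\<lambda>n. v n / real (Suc n) * (real (Suc n) / real n)) \<longlonglongrightarrow> L" by simp
    moreover have "(\<lambda>n. v n / real (Suc n) * (real (Suc n) / real n)) = (\<lambda>n. v n / real n)"
      by (rule ext) (simp del: of_nat_Suc)
    ultimately show "(\<lambda>n. v n / real n) \<longlonglongrightarrow> L" by simp
  next
    assume "(\<lambda>n. v n / real n) \<longlonglongrightarrow> L"
    from tendsto_mult[OF this r] have *: "(\<lambda>n. v n / real n * (real n / real (Suc n))) \<longlonglongrightarrow> L" by simp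
    show "(\<lambda>n. v n / real (Suc n)) \<longlonglongrightarrow> L"
      by (rule Lim_transform_eventually[OF *], rule eventually_sequentiallyI[of 1]) simp
  qed
  finally show ?thesis by simp
qed

subsection \<open>Extremal growth on a residual set\<close>

lemma Trans_hits:
  assumes "y \<in> Trans T" "open U" "U \<noteq> {}"
  obtains k where "(T ^^ k) y \<in> U"
  using assms unfolding Trans_iff by blast

text \<open>If a transitive point \<open>y\<close> has upper growth above \<open>a\<close>, then so has its whole orbit, by the
monotonicity assumption. That orbit is dense, so generically \<open>g n x > a\<close> for infinitely many \<open>n\<close>.
Rational levels below the supremum suffice.\<close>

lemma residual_limsup_eq_SUP:
  fixes T :: "'a::metric_space \<Rightarrow> 'a" and g :: "nat \<Rightarrow> 'a \<Rightarrow> real"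
  assumes cpt: "compact (UNIV :: 'a set)" and T: "continuous_on UNIV T" and tr: "transitive_system T"
    and g: "\<And>n. continuous_on UNIV (g n)"
    and mono: "\<And>x. limsup (\<lambda>n. ereal (g n x)) \<le> limsup (\<lambda>n. ereal (g n (T x)))"
  shows "residual {x \<in> Trans T.
    limsup (\<lambda>n. ereal (g n x)) = (SUP x\<in>Trans T. limsup (\<lambda>n. ereal (g n x)))}"
proof -
  define h where "h x = limsup (\<lambda>n. ereal (g n x))" for x
  define s where "s = (SUP x\<in>Trans T. h x)"
  have mono_k: "h y \<le> h ((T ^^ k) y)" for y k
    by (induction k) (use mono in \<open>auto simp: h_def intro: order_trans\<close>)
  have res: "residual {x. \<exists>\<^sub>F n in sequentially. a < g n x}" if a: "ereal a < s" for a
  proof -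
    obtain y where y: "y \<in> Trans T" "ereal a < h y"
      using a unfolding s_def less_SUP_iff by blast
    have "residual {x. \<exists>\<^sub>F n in sequentially. x \<in> g n -` {a<..}}"
    proof (rule residual_frequently_open[OF cpt])
      show "open (g n -` {a<..})" for n using g by (auto intro!: open_vimage)
      fix U :: "'a set" assume "open U" "U \<noteq> {}"
      then obtain k where k: "(T ^^ k) y \<in> U" using Trans_hits y(1) by metis
      have "ereal a < h ((T ^^ k) y)" using y(2) mono_k by (rule less_le_trans)
      then have "\<exists>\<^sub>F n in sequentially. (T ^^ k) y \<in> g n -` {a<..}"
        unfolding h_def by (auto dest: limsup_gt_frequently)
      then show "\<exists>z\<in>U. \<exists>\<^sub>F n in sequentially. z \<in> g n -` {a<..}" using k by blast
    qed
    then show ?thesis by simp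
  qed
  have "residual (Trans T \<inter> (\<Inter>q\<in>(UNIV :: rat set). {x. ereal (of_rat q) < s \<longrightarrow> ereal (of_rat q) \<le> h x}))"
  proof (intro residual_Int residual_INT_countable cpt residual_Trans T tr)
    fix q :: rat
    show "residual {x. ereal (of_rat q) < s \<longrightarrow> ereal (of_rat q) \<le> h x}"
    proof (cases "ereal (of_rat q) < s")
      case True
      have "{x. \<exists>\<^sub>F n in sequentially. of_rat q < g n x} \<subseteq> {x. ereal (of_rat q) \<le> h x}"
        unfolding h_def by (auto intro!: frequently_le_limsup elim: frequently_elim1)
      then show ?thesis using residual_mono[OF res[OF True]] True by simp
    next
      case False
      then show ?thesis using residual_mono[OF residual_Trans[OF cpt T tr]] by simp
    qed
  qed auto
  moreover have "h x = s" if x: "x \<in> Trans T" "\<And>q :: rat. ereal (of_rat q) < s \<Longrightarrow> ereal (of_rat q) \<le> h x" for x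
  proof (rule antisym)
    show "h x \<le> s" unfolding s_def using x(1) by (rule SUP_upper)
    show "s \<le> h x"
    proof (rule dense_le)
      fix y assume "y < s"
      then obtain b where b: "y < ereal b" "ereal b < s" using ereal_dense2 by blast
      then obtain b' where b': "ereal b < ereal b'" "ereal b' < s" using ereal_dense2 by blast
      then obtain q :: rat where "b < of_rat q" "of_rat q < b'" using of_rat_dense[of b b'] by auto
      then have "ereal b < ereal (of_rat q)" "ereal (of_rat q) < ereal b'" by simp_all
      then have "y < ereal (of_rat q)" "ereal (of_rat q) < s"
        using b(1) b'(2) by (blast intro: less_trans)+
      then show "y \<le> h x" using x(2)[of q] by (simp add: less_imp_le order_trans)
    qed
  qed
  ultimately have "residual {x \<in> Trans T. h x = s}"
    by (elim residual_mono) auto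
  then show ?thesis unfolding s_def h_def .
qed

lemma residual_liminf_eq_INF:
  fixes T :: "'a::metric_space \<Rightarrow> 'a" and g :: "nat \<Rightarrow> 'a \<Rightarrow> real"
  assumes cpt: "compact (UNIV :: 'a set)" and T: "continuous_on UNIV T" and tr: "transitive_system T"
    and g: "\<And>n. continuous_on UNIV (g n)"
    and mono: "\<And>x. liminf (\<lambda>n. ereal (g n (T x))) \<le> liminf (\<lambda>n. ereal (g n x))"
  shows "residual {x \<in> Trans T.
    liminf (\<lambda>n. ereal (g n x)) = (INF x\<in>Trans T. liminf (\<lambda>n. ereal (g n x)))}"
proof -
  have *: "limsup (\<lambda>n. ereal (- g n x)) = - liminf (\<lambda>n. ereal (g n x))" for x
    by (simp add: ereal_Limsup_uminus flip: uminus_ereal.simps)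
  have "residual {x \<in> Trans T. limsup (\<lambda>n. ereal (- g n x)) = (SUP x\<in>Trans T. limsup (\<lambda>n. ereal (- g n x)))}"
    by (rule residual_limsup_eq_SUP[OF cpt T tr])
       (use g mono in \<open>auto simp: * intro!: continuous_on_minus\<close>)
  then show ?thesis
    by (simp add: * ereal_SUP_uminus_eq)
qed

lemma residual_growth_eq_sup:
  fixes T :: "'a::metric_space \<Rightarrow> 'a" and f :: "nat \<Rightarrow> 'a \<Rightarrow>\<^sub>C real"
  assumes cpt: "compact (UNIV :: 'a set)" and T: "continuous_on UNIV T" and tr: "transitive_system T"
    and f: "subadditive_seq T f"
  shows "residual {x \<in> Trans T. growth f x = growth_sup T f}"
  unfolding growth_def growth_sup_def
proof (rule residual_limsup_eq_SUP[OF cpt T tr])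
  show "continuous_on UNIV (\<lambda>x. apply_bcontfun (f n) x / real n)" for n
    by (cases "n = 0") (auto intro!: continuous_intros)
  show "limsup (\<lambda>n. ereal (apply_bcontfun (f n) x / real n))
      \<le> limsup (\<lambda>n. ereal (apply_bcontfun (f n) (T x) / real n))" for x
  proof (rule limsup_average_mono_shift[of "\<lambda>n. apply_bcontfun (f n) x" _ "apply_bcontfun (f 1) x"])
    fix n :: nat assume "n \<ge> 1"
    then have "apply_bcontfun (f (1 + n)) x \<le> apply_bcontfun (f n) ((T ^^ 1) x) + apply_bcontfun (f 1) x"
      using f unfolding subadditive_seq_def by blast
    then show "apply_bcontfun (f (Suc n)) x \<le> apply_bcontfun (f n) (T x) + apply_bcontfun (f 1) x"
      by simp
  qed
qed

subsection \<open>Matrix cocycles\<close>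

lemma mat_norm_mult: "mat_norm (A ** B) \<le> mat_norm A * mat_norm B"
  for A B :: "real^'d^'d"
  using onorm_compose[OF matrix_vector_mul_bounded_linear matrix_vector_mul_bounded_linear, of A B]
  by (simp add: o_def matrix_vector_mul_assoc)

lemma mat_norm_pos:
  fixes A :: "real^'d^'d"
  assumes "invertible A"
  shows "0 < mat_norm A"
proof -
  obtain B where B: "A ** B = mat 1" using assms unfolding invertible_def by blast
  have "\<exists>x. A *v x \<noteq> 0"
  proof
    have "A *v (B *v axis undefined 1) = (axis undefined 1 :: real^'d)"
      using B by (simp add: matrix_vector_mul_assoc)
    then show "A *v (B *v axis undefined 1) \<noteq> 0" by (simp add: axis_eq_0_iff)
  qed
  then show ?thesis
    using onorm_pos_lt[OF matrix_vector_mul_bounded_linear, of A] by blast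
qed

lemma mat_norm_diff_le: "\<bar>mat_norm A - mat_norm B\<bar> \<le> mat_norm (A - B)"
  for A B :: "real^'d^'d"
proof -
  have *: "mat_norm A \<le> mat_norm (A - B) + mat_norm B" for A B :: "real^'d^'d"
    using onorm_triangle[OF matrix_vector_mul_bounded_linear matrix_vector_mul_bounded_linear, of "A - B" B]
    by (simp add: algebra_simps)
  have "(*v) (B - A) = (\<lambda>x. - ((A - B) *v x))"
    by (rule ext) (simp add: matrix_vector_mult_diff_rdistrib)
  then have "mat_norm (B - A) = mat_norm (A - B)"
    using onorm_neg[of "(*v) (A - B)"] by simp
  then show ?thesis using *[of A B] *[of B A] by linarith
qed

lemma mat_norm_le_norm: "mat_norm A \<le> real (CARD('d)) * real (CARD('d)) * norm A"
  for A :: "real^'d^'d"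
  by (rule onorm_le_matrix_component) (rule order_trans[OF component_le_norm_cart Finite_Cartesian_Product.norm_nth_le])

lemma continuous_on_mat_norm:
  fixes A :: "'a::topological_space \<Rightarrow> real^'d^'d"
  assumes "continuous_on S A"
  shows "continuous_on S (\<lambda>x. mat_norm (A x))"
proof -
  define C where "C = real (CARD('d)) * real (CARD('d))"
  have "C > 0" unfolding C_def by simp
  have "C-lipschitz_on UNIV (\<lambda>A :: real^'d^'d. mat_norm A)"
  proof (rule lipschitz_onI)
    show "dist (mat_norm A) (mat_norm B) \<le> C * dist A B" for A B :: "real^'d^'d"
      unfolding dist_norm C_def real_norm_def by (rule order_trans[OF mat_norm_diff_le mat_norm_le_norm])
  qed (use \<open>C > 0\<close> in simp)
  then have "continuous_on UNIV (\<lambda>A :: real^'d^'d. mat_norm A)" by (rule lipschitz_on_continuous_on)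
  then show ?thesis using continuous_on_compose2[OF _ assms] by blast
qed

lemma cocycle_Suc_right: "cocycle T A (Suc n) x = cocycle T A n (T x) ** A x"
  by (induction n) (simp_all add: matrix_mul_assoc[symmetric] funpow_swap1)

lemma invertible_cocycle: "(\<And>x. invertible (A x)) \<Longrightarrow> invertible (cocycle T A n x)"
  by (induction n) (auto intro: invertible_mult simp: invertible_def[of "mat 1"] intro!: exI[of _ "mat 1"])

lemma continuous_on_matrix_mult:
  fixes A B :: "'a::topological_space \<Rightarrow> real^'d^'d"
  assumes "continuous_on S A" "continuous_on S B"
  shows "continuous_on S (\<lambda>x. A x ** B x)"
  unfolding matrix_matrix_mult_def
  using assms by (intro continuous_intros) 

lemma continuous_on_cocycle:
  fixes A :: "'a::topological_space \<Rightarrow> real^'d^'d"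
  assumes T: "continuous_on UNIV T" and A: "continuous_on UNIV A"
  shows "continuous_on UNIV (cocycle T A n)"
proof (induction n)
  case (Suc n)
  have "continuous_on UNIV (\<lambda>x. A ((T ^^ n) x))"
    using continuous_on_compose2[OF A continuous_on_funpow[OF T]] by simp
  from continuous_on_matrix_mult[OF this Suc] show ?case by simp
qed (simp add: continuous_on_const)

text \<open>One step of the cocycle changes the logarithm of the norm by a bounded amount in both directions.
The first inequality is subadditivity; the second one uses that \<open>A x\<close> can be inverted.\<close>

lemma log_norm_cocycle_Suc:
  assumes A: "\<And>x. invertible (A x)"
  shows "ln (mat_norm (cocycle T A (Suc n) x)) \<le> ln (mat_norm (cocycle T A n (T x))) + ln (mat_norm (A x))"
    and "ln (mat_norm (cocycle T A n (T x))) \<le>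
      ln (mat_norm (cocycle T A (Suc n) x)) + ln (mat_norm (matrix_inv (A x)))"
proof -
  note pos = mat_norm_pos[OF invertible_cocycle[where A = A, OF A]] mat_norm_pos[OF A]
  have log_le: "ln a \<le> ln b + ln c" if "0 < a" "0 < b" "0 < c" "a \<le> b * c" for a b c :: real
    using that by (subst ln_mult_pos[symmetric]) auto
  show "ln (mat_norm (cocycle T A (Suc n) x)) \<le> ln (mat_norm (cocycle T A n (T x))) + ln (mat_norm (A x))"
    by (rule log_le[OF pos(1) pos(1) pos(2)]) (simp only: cocycle_Suc_right mat_norm_mult)
  have inv: "A x ** matrix_inv (A x) = mat 1" "matrix_inv (A x) ** A x = mat 1"
    using A[of x] someI_ex[of "\<lambda>B. A x ** B = mat 1 \<and> B ** A x = mat 1"]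
    unfolding invertible_def matrix_inv_def by blast+
  then have "invertible (matrix_inv (A x))" unfolding invertible_def by blast
  note pos' = mat_norm_pos[OF this]
  have "cocycle T A n (T x) = cocycle T A (Suc n) x ** matrix_inv (A x)"
    unfolding cocycle_Suc_right using inv by (simp add: matrix_mul_assoc[symmetric])
  then have "mat_norm (cocycle T A n (T x)) \<le> mat_norm (cocycle T A (Suc n) x) * mat_norm (matrix_inv (A x))"
    by (metis mat_norm_mult)
  then show "ln (mat_norm (cocycle T A n (T x))) \<le>
      ln (mat_norm (cocycle T A (Suc n) x)) + ln (mat_norm (matrix_inv (A x)))"
    by (rule log_le[OF pos(1) pos(1) pos'])
qed

lemma continuous_on_lyap_seq:
  fixes A :: "'a::topological_space \<Rightarrow> real^'d^'d"
  assumes T: "continuous_on UNIV T" and A: "A \<in> C_GL"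
  shows "continuous_on UNIV (\<lambda>x. lyap_seq T A x n)"
proof (cases "n = 0")
  case False
  have "continuous_on UNIV A" "\<And>x. invertible (A x)" using A unfolding C_GL_def by auto
  moreover from this have "mat_norm (cocycle T A n x) \<noteq> 0" for x
    using mat_norm_pos[OF invertible_cocycle, of A T n x] by simp
  ultimately show ?thesis
    unfolding lyap_seq_def using False
    by (intro continuous_intros continuous_on_mat_norm continuous_on_cocycle T) auto
qed (simp add: lyap_seq_def)

lemma residual_upper_lyap_eq_sup:
  fixes T :: "'a::metric_space \<Rightarrow> 'a" and A :: "'a \<Rightarrow> real^'d^'d"
  assumes cpt: "compact (UNIV :: 'a set)" and T: "continuous_on UNIV T" and tr: "transitive_system T"
    and A: "A \<in> C_GL"
  shows "residual {x \<in> Trans T. upper_lyap T A x = lyap_sup T A}"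
  unfolding upper_lyap_def lyap_sup_def
proof (rule residual_limsup_eq_SUP[OF cpt T tr continuous_on_lyap_seq[OF T A]])
  show "limsup (\<lambda>n. ereal (lyap_seq T A x n)) \<le> limsup (\<lambda>n. ereal (lyap_seq T A (T x) n))" for x
    unfolding lyap_seq_def
    by (rule limsup_average_mono_shift, rule log_norm_cocycle_Suc(1)) (use A in \<open>simp add: C_GL_def\<close>)
qed

lemma residual_lower_lyap_eq_inf:
  fixes T :: "'a::metric_space \<Rightarrow> 'a" and A :: "'a \<Rightarrow> real^'d^'d"
  assumes cpt: "compact (UNIV :: 'a set)" and T: "continuous_on UNIV T" and tr: "transitive_system T"
    and A: "A \<in> C_GL"
  shows "residual {x \<in> Trans T. lower_lyap T A x = lyap_inf T A}"
  unfolding lower_lyap_def lyap_inf_def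
proof (rule residual_liminf_eq_INF[OF cpt T tr continuous_on_lyap_seq[OF T A]])
  show "liminf (\<lambda>n. ereal (lyap_seq T A (T x) n)) \<le> liminf (\<lambda>n. ereal (lyap_seq T A x n))" for x
    unfolding lyap_seq_def
    by (rule liminf_average_mono_shift, rule log_norm_cocycle_Suc(2)) (use A in \<open>simp add: C_GL_def\<close>)
qed

text \<open>A generic point realizes the extremal upper and the extremal lower exponent at the same time.\<close>

lemma residual_LI:
  fixes T :: "'a::metric_space \<Rightarrow> 'a" and A :: "'a \<Rightarrow> real^'d^'d"
  assumes cpt: "compact (UNIV :: 'a set)" and T: "continuous_on UNIV T" and tr: "transitive_system T"
    and A: "A \<in> C_GL" and neq: "lyap_inf T A \<noteq> lyap_sup T A"
  shows "residual (LI T A)"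
proof -
  have "residual ({x \<in> Trans T. upper_lyap T A x = lyap_sup T A} \<inter>
      {x \<in> Trans T. lower_lyap T A x = lyap_inf T A})"
    by (intro residual_Int cpt residual_upper_lyap_eq_sup residual_lower_lyap_eq_inf T tr A)
  moreover have "x \<in> LI T A" if x: "upper_lyap T A x = lyap_sup T A" "lower_lyap T A x = lyap_inf T A" for x
  proof (rule ccontr)
    assume "x \<notin> LI T A"
    then obtain L where "lyap_seq T A x \<longlonglongrightarrow> L" unfolding LI_def convergent_def by auto
    then have "(\<lambda>n. ereal (lyap_seq T A x n)) \<longlonglongrightarrow> ereal L" by simp
    then have "upper_lyap T A x = lower_lyap T A x"
      unfolding upper_lyap_def lower_lyap_def
      using lim_imp_Liminf[OF sequentially_bot] lim_imp_Limsup[OF sequentially_bot] by metis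
    then show False using neq x by simp
  qed
  ultimately show ?thesis by (elim residual_mono) blast
qed

lemma vimage_LI:
  assumes A: "\<And>x. invertible (A x)"
  shows "T -` LI T A = LI T A"
proof -
  have "convergent (lyap_seq T A (T x)) \<longleftrightarrow> convergent (lyap_seq T A x)" for x
  proof -
    define c where "c = max (ln (mat_norm (A x))) (ln (mat_norm (matrix_inv (A x))))"
    have "\<bar>ln (mat_norm (cocycle T A (Suc n) x)) - ln (mat_norm (cocycle T A n (T x)))\<bar> \<le> c" for n
      using log_norm_cocycle_Suc[where A=A and T=T and n=n and x=x, OF A] unfolding c_def by linarith
    from average_shift_tendsto_iff[of "\<lambda>n. ln (mat_norm (cocycle T A n x))" , OF this]
    show ?thesis unfolding convergent_def lyap_seq_def by simp
  qed
  then show ?thesis unfolding LI_def by auto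
qed

section \<open>Separability of spaces of continuous functions\<close>

text \<open>A continuous function is described up to a small error by finitely many balls that cover the space
and approximate values on them, taken from a countable dense set. There are only countably many such
descriptions, and one member of \<open>R\<close> is chosen for each description that some member of \<open>R\<close> fits.
In this form the lemma gives countable dense subsets inside an arbitrary family \<open>R\<close>.\<close>

lemma countable_uniformly_dense_subset:
  fixes R :: "('a::metric_space \<Rightarrow> 'b::{metric_space, second_countable_topology}) set"
  assumes cpt: "compact (UNIV :: 'a set)" and R: "\<And>f. f \<in> R \<Longrightarrow> continuous_on UNIV f"
  obtains D where "countable D" "D \<subseteq> R"
    "\<And>f e. f \<in> R \<Longrightarrow> 0 < e \<Longrightarrow> \<exists>g\<in>D. \<forall>x. dist (f x) (g x) < e"
proof -
  obtain c :: "nat \<Rightarrow> 'a" and r :: "nat \<Rightarrow> real" where r: "\<And>i. 0 < r i"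
    and cr: "\<And>e. 0 < e \<Longrightarrow> \<exists>N. \<forall>x. \<exists>i<N. dist (c i) x < r i \<and> r i < e"
    using compact_ball_sequence[OF cpt] by metis
  obtain Q :: "'b set" where Q: "countable Q" "\<And>X. open X \<Longrightarrow> X \<noteq> {} \<Longrightarrow> \<exists>d\<in>Q. d \<in> X"
    using countable_dense_setE by blast
  define q where "q = from_nat_into Q"
  have q: "\<exists>j. dist y (q j) < e" if e: "0 < e" for y e
  proof -
    obtain d where "d \<in> Q" "d \<in> ball y e" using Q(2)[of "ball y e"] e by auto
    then show ?thesis using from_nat_into_surj[OF Q(1)] unfolding q_def by (metis mem_ball)
  qed
  \<comment> \<open>A pair \<open>(i, j)\<close> says that \<open>f\<close> is close to the value \<open>q j\<close> on the ball number \<open>i\<close>.\<close>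
  define fits :: "(nat \<times> nat) list \<Rightarrow> nat \<Rightarrow> ('a \<Rightarrow> 'b) \<Rightarrow> bool" where
    "fits p k f \<longleftrightarrow> (\<forall>x. \<exists>(i, j)\<in>set p. dist (c i) x < r i) \<and>
      (\<forall>(i, j)\<in>set p. \<forall>x. dist (c i) x < r i \<longrightarrow> dist (f x) (q j) < inverse (real (Suc k)))" for p k f
  have ex_fits: "\<exists>p. fits p k f" if f: "continuous_on UNIV f" for f k
  proof -
    define \<epsilon> where "\<epsilon> = inverse (real (Suc k))"
    have "0 < \<epsilon>" unfolding \<epsilon>_def by simp
    have "uniformly_continuous_on UNIV f" using f cpt by (rule compact_uniformly_continuous)
    then obtain \<delta> where \<delta>: "0 < \<delta>" "\<And>x y. dist x y < \<delta> \<Longrightarrow> dist (f x) (f y) < \<epsilon> / 2"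
      unfolding uniformly_continuous_on_def using \<open>0 < \<epsilon>\<close> by (metis UNIV_I half_gt_zero)
    obtain N where N: "\<forall>x. \<exists>i<N. dist (c i) x < r i \<and> r i < \<delta>" using cr[OF \<delta>(1)] by blast
    have "\<exists>j. dist (f (c i)) (q j) < \<epsilon> / 2" for i using q[of "\<epsilon> / 2"] \<open>0 < \<epsilon>\<close> by simp
    then obtain j where j: "\<And>i. dist (f (c i)) (q (j i)) < \<epsilon> / 2" by metis
    define p where "p = map (\<lambda>i. (i, j i)) (filter (\<lambda>i. r i < \<delta>) [0..<N])"
    have "\<exists>(i, j)\<in>set p. dist (c i) x < r i" for x
      using N unfolding p_def by fastforce
    moreover have "dist (f x) (q (j i)) < \<epsilon>" if "r i < \<delta>" "dist (c i) x < r i" for i x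
    proof -
      have "dist (f x) (f (c i)) < \<epsilon> / 2" using \<delta>(2)[of x "c i"] that by (simp add: dist_commute)
      then show ?thesis using j[of i] dist_triangle[of "f x" "q (j i)" "f (c i)"] by linarith
    qed
    then have "\<forall>(i, j)\<in>set p. \<forall>x. dist (c i) x < r i \<longrightarrow> dist (f x) (q j) < \<epsilon>"
      unfolding p_def by auto
    ultimately show ?thesis unfolding fits_def \<epsilon>_def by blast
  qed
  define pick where "pick = (\<lambda>(p, k). SOME f. f \<in> R \<and> fits p k f)"
  define D where "D = pick ` {(p, k). \<exists>f\<in>R. fits p k f}"
  have pick: "pick (p, k) \<in> R \<and> fits p k (pick (p, k))" if "f \<in> R" "fits p k f" for p k f
    unfolding pick_def prod.case using that by (intro someI_ex[of "\<lambda>f. f \<in> R \<and> fits p k f"]) blast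
  show thesis
  proof (rule that[of D])
    show "countable D" unfolding D_def by (intro countable_image) simp
    show "D \<subseteq> R" unfolding D_def using pick by auto
    fix f and e :: real assume f: "f \<in> R" and e: "0 < e"
    obtain k where k: "inverse (real (Suc k)) < e / 2" using reals_Archimedean[of "e / 2"] e by auto
    obtain p where p: "fits p k f" using ex_fits R[OF f] by blast
    have "dist (f x) (pick (p, k) x) < e" for x
    proof -
      have fp: "fits p k (pick (p, k))" using pick[OF f p] by blast
      obtain i j where "(i, j) \<in> set p" "dist (c i) x < r i" using p unfolding fits_def by blast
      then have "dist (f x) (q j) < inverse (real (Suc k))"
        "dist (pick (p, k) x) (q j) < inverse (real (Suc k))"
        using p fp unfolding fits_def by blast+
      then show ?thesis using k dist_triangle2[of "f x" "pick (p, k) x" "q j"] by linarith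
    qed
    moreover have "pick (p, k) \<in> D" unfolding D_def using f p by blast
    ultimately show "\<exists>g\<in>D. \<forall>x. dist (f x) (g x) < e" by blast
  qed
qed

lemma bounded_continuous_dense_sequence:
  assumes cpt: "compact (UNIV :: 'a::metric_space set)"
  obtains g :: "nat \<Rightarrow> 'a::metric_space \<Rightarrow>\<^sub>C real"
  where "\<And>f e. 0 < e \<Longrightarrow> \<exists>i. \<forall>x. dist (apply_bcontfun f x) (apply_bcontfun (g i) x) < e"
proof -
  obtain D where D: "countable D" "D \<subseteq> range (apply_bcontfun :: ('a \<Rightarrow>\<^sub>C real) \<Rightarrow> _)"
    "\<And>f e. f \<in> range (apply_bcontfun :: ('a \<Rightarrow>\<^sub>C real) \<Rightarrow> _) \<Longrightarrow> 0 < e \<Longrightarrow> \<exists>g\<in>D. \<forall>x. dist (f x) (g x) < e"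
    by (rule countable_uniformly_dense_subset[OF cpt, of "range (apply_bcontfun :: ('a \<Rightarrow>\<^sub>C real) \<Rightarrow> _)"]) auto
  show thesis
  proof (rule that[of "\<lambda>i. Bcontfun (from_nat_into D i)"])
    fix f :: "'a \<Rightarrow>\<^sub>C real" and e :: real assume e: "0 < e"
    obtain g where g: "g \<in> D" "\<forall>x. dist (f x) (g x) < e" using D(3)[OF rangeI e, of f] by blast
    obtain i where "from_nat_into D i = g" using from_nat_into_surj[OF D(1) g(1)] by blast
    moreover obtain g' :: "'a \<Rightarrow>\<^sub>C real" where "g = apply_bcontfun g'" using D(2) g(1) by blast
    ultimately show "\<exists>i. \<forall>x. dist (f x) (apply_bcontfun (Bcontfun (from_nat_into D i)) x) < e"
      using g(2) by (intro exI[of _ i]) (simp add: apply_bcontfun_inverse)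
  qed
qed

section \<open>Probability measures on a compact metric space\<close>

lemma borel_measurable_bcontfun [measurable]: "apply_bcontfun f \<in> borel_measurable borel"
  for f :: "'a::topological_space \<Rightarrow>\<^sub>C real"
  by (intro borel_measurable_continuous_onI) simp

lemma prob_measures_D:
  assumes "\<mu> \<in> prob_measures"
  shows "prob_space \<mu>" "sets \<mu> = sets borel" "space \<mu> = UNIV"
  using assms sets_eq_imp_space_eq[of \<mu> borel] unfolding prob_measures_def by auto

lemma integrable_bcontfun:
  fixes f :: "'a::topological_space \<Rightarrow>\<^sub>C real"
  assumes "\<mu> \<in> prob_measures"
  shows "integrable \<mu> (apply_bcontfun f)"
proof -
  interpret prob_space \<mu> using prob_measures_D(1)[OF assms] .
  have "apply_bcontfun f \<in> borel_measurable \<mu>"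
    using borel_measurable_bcontfun measurable_cong_sets[OF prob_measures_D(2)[OF assms] refl] by blast
  then show ?thesis
    by (intro integrable_const_bound[of _ "norm f"]) (auto simp: norm_bounded[of f, simplified])
qed

lemma abs_integral_bcontfun_diff_le:
  fixes f g :: "'a::topological_space \<Rightarrow>\<^sub>C real"
  assumes "\<mu> \<in> prob_measures" "\<And>x. \<bar>f x - g x\<bar> \<le> e"
  shows "\<bar>(LINT x|\<mu>. f x) - (LINT x|\<mu>. g x)\<bar> \<le> e"
proof -
  interpret prob_space \<mu> using prob_measures_D(1)[OF assms(1)] .
  note int = integrable_bcontfun[OF assms(1)]
  have "\<bar>(LINT x|\<mu>. f x) - (LINT x|\<mu>. g x)\<bar> = \<bar>LINT x|\<mu>. f x - g x\<bar>"
    by (simp add: Bochner_Integration.integral_diff[OF int int])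
  also have "\<dots> \<le> (LINT x|\<mu>. \<bar>f x - g x\<bar>)" by (rule integral_abs_bound)
  also have "\<dots> \<le> (LINT x|\<mu>. e)"
    using assms(2) int by (intro integral_mono) auto
  finally show ?thesis by (simp add: prob_space)
qed

lemma abs_integral_bcontfun_le:
  fixes f :: "'a::topological_space \<Rightarrow>\<^sub>C real"
  assumes "\<mu> \<in> prob_measures"
  shows "\<bar>LINT x|\<mu>. f x\<bar> \<le> norm f"
  using abs_integral_bcontfun_diff_le[OF assms, of f 0 "norm f"] norm_bounded[of f]
  by simp

text \<open>The indicator of a closed set \<open>C\<close> is the limit of the continuous functions
\<open>max 0 (1 - k * infdist x C)\<close>, so the integrals of continuous functions determine the measure on
closed sets, which form a generating family closed under intersections.\<close>

lemma prob_measures_eqI: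
  fixes \<mu> \<nu> :: "'a::metric_space measure"
  assumes \<mu>: "\<mu> \<in> prob_measures" and \<nu>: "\<nu> \<in> prob_measures"
    and eq: "\<And>f :: 'a \<Rightarrow>\<^sub>C real. (LINT x|\<mu>. f x) = (LINT x|\<nu>. f x)"
  shows "\<mu> = \<nu>"
proof (rule measure_eqI_generator_eq[where E = "Collect closed" and \<Omega> = UNIV and A = "\<lambda>_. UNIV"])
  fix C :: "'a set" assume "C \<in> Collect closed"
  then have C: "closed C" by simp
  interpret \<mu>: prob_space \<mu> using prob_measures_D(1)[OF \<mu>] .
  interpret \<nu>: prob_space \<nu> using prob_measures_D(1)[OF \<nu>] .
  show "emeasure \<mu> C = emeasure \<nu> C"
  proof (cases "C = {}")
    case False
    define h where "h k x = max 0 (1 - real k * infdist x C)" for k x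
    have cont: "continuous_on UNIV (h k)" for k
      unfolding h_def by (intro continuous_intros continuous_on_infdist)
    have bnd: "\<bar>h k x\<bar> \<le> 1" for k x
      unfolding h_def using infdist_nonneg[of x C] by (simp add: max_def)
    have "h k \<in> bcontfun" for k
      by (intro bcontfun_normI[of _ 1] cont) (use bnd in simp)
    then have eq_h: "(LINT x|\<mu>. h k x) = (LINT x|\<nu>. h k x)" for k
      using eq[of "Bcontfun (h k)"] by (simp add: Bcontfun_inverse)
    have lim: "(\<lambda>k. h k x) \<longlonglongrightarrow> indicator C x" for x
    proof (cases "x \<in> C")
      case True
      then show ?thesis by (simp add: h_def)
    next
      case F: False
      then have "0 < infdist x C" using C False infdist_pos_not_in_closed by blast
      then obtain k0 :: nat where "1 < real k0 * infdist x C" using reals_Archimedean3 by blast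
      then have "h k x = 0" if "k \<ge> k0" for k
        using mult_right_mono[of "real k0" "real k" "infdist x C"] that infdist_nonneg[of x C]
        unfolding h_def by simp
      then have "\<forall>\<^sub>F k in sequentially. h k x = indicator C x"
        using F by (auto simp: eventually_sequentially)
      then show ?thesis by (rule tendsto_eventually)
    qed
    have *: "(\<lambda>k. LINT x|M. h k x) \<longlonglongrightarrow> measure M C" if M: "M \<in> prob_measures" for M :: "'a measure"
    proof -
      interpret M: prob_space M using prob_measures_D(1)[OF M] .
      have [measurable_cong]: "sets M = sets borel" using prob_measures_D(2)[OF M] .
      have [measurable]: "h k \<in> borel_measurable borel" for k
        using cont by (rule borel_measurable_continuous_onI)
      have [measurable]: "C \<in> sets borel" using C by simp
      have "(\<lambda>k. LINT x|M. h k x) \<longlonglongrightarrow> (LINT x|M. indicator C x)"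
        by (rule integral_dominated_convergence[where w = "\<lambda>_. 1"]) (use lim bnd in auto)
      then show ?thesis using prob_measures_D(3)[OF M] by simp
    qed
    have "measure \<mu> C = measure \<nu> C"
      using LIMSEQ_unique[OF *[OF \<mu>]] *[OF \<nu>] eq_h by simp
    then show ?thesis by (simp add: \<mu>.emeasure_eq_measure \<nu>.emeasure_eq_measure)
  qed simp
next
  show "Int_stable (Collect closed :: 'a set set)" by (auto simp: Int_stable_def)
  have "sets borel = sigma_sets UNIV (Collect closed :: 'a set set)"
    unfolding borel_eq_closed by (simp add: sets_measure_of)
  then show "sets \<mu> = sigma_sets UNIV (Collect closed)" "sets \<nu> = sigma_sets UNIV (Collect closed)"
    using prob_measures_D(2) \<mu> \<nu> by blast+
  show "emeasure \<mu> UNIV \<noteq> \<infinity>" for i :: nat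
    using prob_measures_D[OF \<mu>] finite_measure.emeasure_finite[of \<mu> UNIV] prob_space_def by auto
qed auto

subsection \<open>Weak sequential compactness\<close>

text \<open>The first place \<open>n\<close> where the digits differ contributes \<open>3^-n\<close> to the difference of the two sums,
and all later places together at most half of that.\<close>

lemma ternary_digits_eq:
  fixes b :: "nat \<Rightarrow> bool" and b' :: "nat \<Rightarrow> bool"
  assumes close: "\<bar>(\<Sum>i. of_bool (b i) * (1/3) ^ i) - (\<Sum>i. of_bool (b' i) * (1/3) ^ i)\<bar> < (1/3 :: real) ^ N / 2"
    and i: "i < N"
  shows "b i = b' i"
proof (rule ccontr)
  assume "b i \<noteq> b' i"
  define n where "n = (LEAST j. b j \<noteq> b' j)"
  have n: "b n \<noteq> b' n" "\<And>j. j < n \<Longrightarrow> b j = b' j" "n \<le> i"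
    unfolding n_def using LeastI[of "\<lambda>j. b j \<noteq> b' j" i] not_less_Least Least_le[of "\<lambda>j. b j \<noteq> b' j" i]
      \<open>b i \<noteq> b' i\<close> by blast+
  define d :: "nat \<Rightarrow> real" where "d j = (of_bool (b j) - of_bool (b' j)) * (1/3) ^ j" for j
  have summable_code: "summable (\<lambda>i. of_bool (b i) * (1/3 :: real) ^ i)" for b :: "nat \<Rightarrow> bool"
    by (rule summable_comparison_test'[where g = "\<lambda>i. (1/3) ^ i" and N = 0]) (auto intro: summable_geometric)
  have sd: "summable d"
    unfolding d_def left_diff_distrib by (intro summable_diff summable_code)
  have "(\<Sum>i. of_bool (b i) * (1/3) ^ i) - (\<Sum>i. of_bool (b' i) * (1/3) ^ i) = suminf d"
    unfolding d_def left_diff_distrib by (intro suminf_diff summable_code)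
  also have "\<dots> = (\<Sum>j. d (j + Suc n)) + sum d {..<Suc n}"
    by (rule suminf_split_initial_segment[OF sd])
  also have "sum d {..<Suc n} = d n"
    using n(2) by (simp add: d_def)
  finally have eq: "(\<Sum>i. of_bool (b i) * (1/3) ^ i) - (\<Sum>i. of_bool (b' i) * (1/3) ^ i) =
    (\<Sum>j. d (j + Suc n)) + d n" .
  have "\<bar>d n\<bar> = (1/3) ^ n" using n(1) by (cases "b n"; cases "b' n") (auto simp: d_def)
  moreover have "\<bar>\<Sum>j. d (j + Suc n)\<bar> \<le> (\<Sum>j. (1/3) ^ Suc n * (1/3) ^ j)"
  proof -
    have le: "norm (d (j + Suc n)) \<le> (1/3) ^ Suc n * (1/3) ^ j" for j
      unfolding d_def by (auto simp: power_add)
    have "norm (\<Sum>j. d (j + Suc n)) \<le> (\<Sum>j. (1/3) ^ Suc n * (1/3) ^ j)"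
      by (rule norm_suminf_le[OF le]) (intro summable_mult summable_geometric, simp)
    then show ?thesis by simp
  qed
  moreover have "(\<Sum>j. (1/3) ^ Suc n * (1/3 :: real) ^ j) = (1/3) ^ n / 2"
    by (subst suminf_mult) (auto simp: suminf_geometric summable_geometric)
  ultimately have "\<bar>(\<Sum>i. of_bool (b i) * (1/3) ^ i) - (\<Sum>i. of_bool (b' i) * (1/3) ^ i)\<bar> \<ge> (1/3 :: real) ^ n / 2"
    unfolding eq by linarith
  moreover have "(1/3 :: real) ^ N \<le> (1/3) ^ n"
    using n(3) i by (intro power_decreasing) auto
  ultimately show False using close by linarith
qed

text \<open>The ternary digits of \<open>\<sigma> x\<close> record to which balls of the sequence \<open>x\<close> belongs. Points with close
codes agree on many digits and therefore lie in a common small ball. The code itself is in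
general only Borel, but its inverse is uniformly continuous.\<close>

lemma compact_metric_real_code:
  assumes cpt: "compact (UNIV :: 'a::metric_space set)"
  obtains \<sigma> :: "'a::metric_space \<Rightarrow> real" where "\<sigma> \<in> borel_measurable borel" "\<And>x. 0 \<le> \<sigma> x" "\<And>x. \<sigma> x \<le> 2"
    "\<And>e. 0 < e \<Longrightarrow> \<exists>\<delta>>0. \<forall>x y. \<bar>\<sigma> x - \<sigma> y\<bar> < \<delta> \<longrightarrow> dist x y < e"
proof -
  obtain c :: "nat \<Rightarrow> 'a" and r :: "nat \<Rightarrow> real" where r: "\<And>i. 0 < r i"
    and cr: "\<And>e. 0 < e \<Longrightarrow> \<exists>N. \<forall>x. \<exists>i<N. dist (c i) x < r i \<and> r i < e"
    using compact_ball_sequence[OF cpt] by metis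
  define \<sigma> :: "'a \<Rightarrow> real" where "\<sigma> x = (\<Sum>i. of_bool (dist (c i) x < r i) * (1/3) ^ i)" for x
  have sm: "summable (\<lambda>i. of_bool (P i) * (1/3 :: real) ^ i)" for P
    by (rule summable_comparison_test'[where g = "\<lambda>i. (1/3) ^ i" and N = 0]) (auto intro: summable_geometric)
  show thesis
  proof (rule that[of \<sigma>])
    have "(\<lambda>x. of_bool (dist (c i) x < r i) * (1/3) ^ i :: real) \<in> borel_measurable borel" for i
    proof -
      have "(\<lambda>x. of_bool (dist (c i) x < r i) * (1/3) ^ i :: real) = (\<lambda>x. indicator (ball (c i) (r i)) x * (1/3) ^ i)"
        by (auto simp: indicator_def)
      then show ?thesis by (simp add: borel_measurable_times borel_measurable_indicator)
    qed
    then show "\<sigma> \<in> borel_measurable borel"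
      unfolding \<sigma>_def by (intro borel_measurable_suminf)
    show "0 \<le> \<sigma> x" for x unfolding \<sigma>_def by (intro suminf_nonneg sm) auto
    show "\<sigma> x \<le> 2" for x
    proof -
      have "\<sigma> x \<le> (\<Sum>i. (1/3) ^ i)"
        unfolding \<sigma>_def by (intro suminf_le sm summable_geometric) auto
      also have "\<dots> \<le> 2" by (simp add: suminf_geometric)
      finally show ?thesis .
    qed
    fix e :: real assume "0 < e"
    then obtain N where N: "\<forall>x. \<exists>i<N. dist (c i) x < r i \<and> r i < e / 2" using cr[of "e / 2"] by auto
    show "\<exists>\<delta>>0. \<forall>x y. \<bar>\<sigma> x - \<sigma> y\<bar> < \<delta> \<longrightarrow> dist x y < e"
    proof (rule exI[of _ "(1/3) ^ N / 2"], intro conjI allI impI)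
      fix x y assume xy: "\<bar>\<sigma> x - \<sigma> y\<bar> < (1/3) ^ N / 2"
      obtain i where i: "i < N" "dist (c i) x < r i" "r i < e / 2" using N by blast
      have "dist (c i) y < r i"
        using ternary_digits_eq[OF xy[unfolded \<sigma>_def] i(1)] i(2) by simp
      then show "dist x y < e" using i dist_triangle3[of x y "c i"] by linarith
    qed simp
  qed
qed

text \<open>The inverse of the code extends to the closure of the range: for a limit \<open>s\<close> of codes \<open>\<sigma> (u n)\<close>,
compactness provides a limit point of \<open>u\<close>, and uniform continuity makes it independent of \<open>u\<close>.\<close>

lemma left_inverse_of_real_code:
  fixes \<sigma> :: "'a::metric_space \<Rightarrow> real"
  assumes cpt: "compact (UNIV :: 'a set)"
    and \<sigma>: "\<And>e. 0 < e \<Longrightarrow> \<exists>\<delta>>0. \<forall>x y. \<bar>\<sigma> x - \<sigma> y\<bar> < \<delta> \<longrightarrow> dist x y < e"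
  obtains \<pi> :: "real \<Rightarrow> 'a" where "continuous_on (closure (range \<sigma>)) \<pi>" "\<And>x. \<pi> (\<sigma> x) = x"
proof -
  let ?K = "closure (range \<sigma>)"
  have "\<exists>x u. (\<lambda>n. \<sigma> (u n)) \<longlonglongrightarrow> s \<and> u \<longlonglongrightarrow> x" if s: "s \<in> ?K" for s
  proof -
    obtain t where t: "\<forall>n. t n \<in> range \<sigma>" "t \<longlonglongrightarrow> s"
      using s unfolding closure_sequential by blast
    then have "\<forall>n. \<exists>x. t n = \<sigma> x" by (simp add: image_iff)
    then obtain v where v: "\<And>n. t n = \<sigma> (v n)" by metis
    obtain x \<rho> where x: "strict_mono \<rho>" "(v \<circ> \<rho>) \<longlonglongrightarrow> x"
      using compact_imp_seq_compact[OF cpt] unfolding seq_compact_def by (metis UNIV_I)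
    have "(t \<circ> \<rho>) \<longlonglongrightarrow> s" using LIMSEQ_subseq_LIMSEQ[OF t(2) x(1)] .
    then show ?thesis using x(2) v by (intro exI[of _ x] exI[of _ "v \<circ> \<rho>"]) (simp add: o_def)
  qed
  then obtain \<pi> u where u: "\<And>s. s \<in> ?K \<Longrightarrow> (\<lambda>n. \<sigma> (u s n)) \<longlonglongrightarrow> s" "\<And>s. s \<in> ?K \<Longrightarrow> u s \<longlonglongrightarrow> \<pi> s"
    by metis
  have close: "dist x y \<le> e"
    if "\<forall>x y. \<bar>\<sigma> x - \<sigma> y\<bar> < \<delta> \<longrightarrow> dist x y < e" "\<bar>s - t\<bar> < \<delta>"
      "(\<lambda>n. \<sigma> (v n)) \<longlonglongrightarrow> s" "v \<longlonglongrightarrow> x" "(\<lambda>n. \<sigma> (w n)) \<longlonglongrightarrow> t" "w \<longlonglongrightarrow> y" for v w x y s t \<delta> e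
  proof -
    have "(\<lambda>n. \<bar>\<sigma> (v n) - \<sigma> (w n)\<bar>) \<longlonglongrightarrow> \<bar>s - t\<bar>" using that by (intro tendsto_intros)
    then have "\<forall>\<^sub>F n in sequentially. \<bar>\<sigma> (v n) - \<sigma> (w n)\<bar> < \<delta>"
      using that(2) order_tendstoD(2) by blast
    then have "\<forall>\<^sub>F n in sequentially. dist (v n) (w n) \<le> e"
      by eventually_elim (use that(1) in \<open>auto intro: less_imp_le\<close>)
    moreover have "(\<lambda>n. dist (v n) (w n)) \<longlonglongrightarrow> dist x y" using that by (intro tendsto_intros)
    ultimately show ?thesis by (intro tendsto_upperbound) auto
  qed
  show thesis
  proof (rule that[of \<pi>])
    show "continuous_on ?K \<pi>" unfolding continuous_on_iff
    proof (intro ballI allI impI)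
      fix s and e :: real assume s: "s \<in> ?K" and "0 < e"
      then obtain \<delta> where \<delta>: "\<delta> > 0" "\<forall>x y. \<bar>\<sigma> x - \<sigma> y\<bar> < \<delta> \<longrightarrow> dist x y < e / 2"
        using \<sigma>[of "e / 2"] by auto
      have "dist (\<pi> t) (\<pi> s) < e" if "t \<in> ?K" "dist t s < \<delta>" for t
      proof -
        have "dist (\<pi> t) (\<pi> s) \<le> e / 2"
          using close[OF \<delta>(2) _ u(1)[OF that(1)] u(2)[OF that(1)] u(1)[OF s] u(2)[OF s]] that(2)
          by (simp add: dist_real_def)
        then show ?thesis using \<open>0 < e\<close> by simp
      qed
      then show "\<exists>d>0. \<forall>t\<in>?K. dist t s < d \<longrightarrow> dist (\<pi> t) (\<pi> s) < e" using \<delta>(1) by blast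
    qed
    fix x
    have sK: "\<sigma> x \<in> ?K" by (rule subsetD[OF closure_subset]) simp
    show "\<pi> (\<sigma> x) = x"
    proof (rule ccontr)
      assume "\<pi> (\<sigma> x) \<noteq> x"
      then have pos: "0 < dist (\<pi> (\<sigma> x)) x / 2" by simp
      then obtain \<delta> where \<delta>: "\<delta> > 0" "\<forall>y z. \<bar>\<sigma> y - \<sigma> z\<bar> < \<delta> \<longrightarrow> dist y z < dist (\<pi> (\<sigma> x)) x / 2"
        using \<sigma>[OF pos] by blast
      have "dist (\<pi> (\<sigma> x)) x \<le> dist (\<pi> (\<sigma> x)) x / 2"
        by (rule close[OF \<delta>(2) _ u(1)[OF sK] u(2)[OF sK], of "\<sigma> x" "\<lambda>_. x"]) (use \<delta>(1) in auto)
      then show False using pos by simp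
    qed
  qed
qed

text \<open>The measures are transported to the real line by the code, where they live on a bounded interval and
are therefore tight. Helly's theorem gives a weakly convergent subsequence there. Its limit \<open>L\<close> is
carried by the closure \<open>K\<close> of the range of the code, since the continuous function
\<open>min 1 (infdist s K)\<close> has integral zero against all the measures. So \<open>L\<close> can be mapped back by the
extended inverse \<open>\<pi>\<close>, and test functions on the original space become test functions on the line by
Tietze's theorem.\<close>

theorem prob_measures_seq_compact:
  fixes M :: "nat \<Rightarrow> 'a::metric_space measure"
  assumes cpt: "compact (UNIV :: 'a set)" and M: "\<And>k. M k \<in> prob_measures"
  obtains r :: "nat \<Rightarrow> nat" and \<mu> where "strict_mono r" "\<mu> \<in> prob_measures"
    "\<And>f :: 'a \<Rightarrow>\<^sub>C real. (\<lambda>k. LINT x|M (r k). f x) \<longlonglongrightarrow> (LINT x|\<mu>. f x)"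
proof -
  obtain \<sigma> :: "'a \<Rightarrow> real" where \<sigma>: "\<sigma> \<in> borel_measurable borel" "\<And>x. 0 \<le> \<sigma> x" "\<And>x. \<sigma> x \<le> 2"
    "\<And>e. 0 < e \<Longrightarrow> \<exists>\<delta>>0. \<forall>x y. \<bar>\<sigma> x - \<sigma> y\<bar> < \<delta> \<longrightarrow> dist x y < e"
    by (rule compact_metric_real_code[OF cpt], rule that)
  define K where "K = closure (range \<sigma>)"
  obtain \<pi> :: "real \<Rightarrow> 'a" where \<pi>: "continuous_on K \<pi>" "\<And>x. \<pi> (\<sigma> x) = x"
    using left_inverse_of_real_code[OF cpt \<sigma>(4)] unfolding K_def by blast
  have K: "closed K" "\<And>x. \<sigma> x \<in> K" "K \<noteq> {}" unfolding K_def by (auto intro: subsetD[OF closure_subset])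
  have [measurable]: "\<sigma> \<in> borel_measurable borel" by fact
  have sM [measurable_cong]: "sets (M k) = sets borel" for k using prob_measures_D(2)[OF M] .
  have \<sigma>M [measurable]: "\<sigma> \<in> borel_measurable (M k)" for k by measurable
  define N where "N k = distr (M k) borel \<sigma>" for k
  have N: "real_distribution (N k)" for k
    unfolding N_def using prob_measures_D(1)[OF M] \<sigma>M by (intro prob_space.real_distribution_distr)
  have int_N: "(LINT s|N k. h s) = (LINT x|M k. h (\<sigma> x))" if "continuous_on UNIV h" for h :: "real \<Rightarrow> real" and k
    unfolding N_def by (rule integral_distr[OF \<sigma>M borel_measurable_continuous_onI[OF that]])
  have "tight N" unfolding tight_def
  proof (intro conjI allI impI N)
    fix \<epsilon> :: real assume "\<epsilon> > 0"
    have "measure (N k) {-1<..3} = 1" for k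
    proof -
      have "-1 < \<sigma> x \<and> \<sigma> x \<le> 3" for x using \<sigma>(2,3)[of x] by linarith
      then have "\<sigma> -` {-1<..3} \<inter> space (M k) = space (M k)" by auto
      then have "measure (N k) {-1<..3} = measure (M k) (space (M k))"
        unfolding N_def by (subst measure_distr) auto
      then show ?thesis using prob_space.prob_space[OF prob_measures_D(1)[OF M]] by metis
    qed
    then show "\<exists>a b. a < b \<and> (\<forall>k. 1 - \<epsilon> < measure (N k) {a<..b})"
      using \<open>\<epsilon> > 0\<close> by (intro exI[of _ "-1"] exI[of _ 3]) simp
  qed
  from tight_imp_convergent_subsubsequence[OF this strict_mono_id]
  obtain r L where r: "strict_mono r" and L: "real_distribution L" and NL: "weak_conv_m (N \<circ> r) L"
    by (auto simp: o_def)
  interpret L: real_distribution L by fact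
  have sL [measurable_cong]: "sets L = sets borel" by simp
  have lim: "(\<lambda>k. LINT x|M (r k). h (\<sigma> x)) \<longlonglongrightarrow> (LINT s|L. h s)"
    if h: "continuous_on UNIV h" "\<And>s. \<bar>h s\<bar> \<le> B" for h :: "real \<Rightarrow> real" and B
  proof -
    have "(\<lambda>k. integral\<^sup>L ((N \<circ> r) k) h) \<longlonglongrightarrow> integral\<^sup>L L h"
      by (rule weak_conv_imp_integral_bdd_continuous_conv[OF _ L NL, where B = B])
         (use N h in \<open>auto simp: continuous_on_eq_continuous_at\<close>)
    then show ?thesis by (simp add: int_N[OF h(1)])
  qed
  have AE_K: "AE s in L. s \<in> K"
  proof -
    define h where "h s = min 1 (infdist s K)" for s
    have h: "continuous_on UNIV h" unfolding h_def by (intro continuous_intros)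
    have h1: "\<bar>h s\<bar> \<le> 1" and h0: "0 \<le> h s" for s
      unfolding h_def using infdist_nonneg[of s K] by auto
    have hm [measurable]: "h \<in> borel_measurable borel" by (rule borel_measurable_continuous_onI[OF h])
    have "(LINT s|L. h s) = 0"
      using LIMSEQ_unique[OF lim[OF h h1]] K(2) by (simp add: h_def)
    moreover have "integrable L h"
      by (rule L.integrable_const_bound[of _ 1]) (use h1 in auto)
    ultimately have "AE s in L. h s = 0" using integral_nonneg_eq_0_iff_AE[of L h] h0 by simp
    then show ?thesis
    proof eventually_elim
      case (elim s)
      then have "infdist s K = 0" unfolding h_def by (simp add: min_def split: if_splits)
      then show ?case using in_closed_iff_infdist_zero[OF K(1,3)] by simp
    qed
  qed
  define p where "p s = (if s \<in> K then \<pi> s else undefined)" for s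
  have p [measurable]: "p \<in> borel_measurable borel"
    unfolding p_def using K(1) by (intro borel_measurable_continuous_on_if \<pi>(1)) auto
  have pL [measurable]: "p \<in> borel_measurable L" by measurable
  define \<mu> where "\<mu> = distr L borel p"
  have "\<mu> \<in> prob_measures"
    unfolding \<mu>_def prob_measures_def using L.prob_space_distr[OF pL] by simp
  moreover have "(\<lambda>k. LINT x|M (r k). f x) \<longlonglongrightarrow> (LINT x|\<mu>. f x)" for f :: "'a \<Rightarrow>\<^sub>C real"
  proof -
    have "continuous_on K (\<lambda>s. f (\<pi> s))"
      using continuous_on_compose2[OF continuous_on_apply_bcontfun \<pi>(1)] by blast
    then obtain h :: "real \<Rightarrow> real" where h: "continuous_on UNIV h" "\<And>s. s \<in> K \<Longrightarrow> h s = f (\<pi> s)"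
      "\<And>s. norm (h s) \<le> norm f"
      by (rule Tietze[of K "\<lambda>s. f (\<pi> s)" UNIV "norm f"]) (use K(1) norm_bounded[of f] in auto)
    have hm [measurable]: "h \<in> borel_measurable borel" by (rule borel_measurable_continuous_onI[OF h(1)])
    have "(LINT x|\<mu>. f x) = (LINT s|L. f (p s))"
      unfolding \<mu>_def by (rule integral_distr[OF pL borel_measurable_bcontfun])
    also have "\<dots> = (LINT s|L. h s)"
    proof (rule integral_cong_AE)
      show "(\<lambda>s. f (p s)) \<in> borel_measurable L"
        by (rule measurable_compose[OF pL borel_measurable_bcontfun])
      show "AE s in L. f (p s) = h s" using AE_K by eventually_elim (simp add: p_def h)
    qed simp
    finally show ?thesis
      using lim[OF h(1), of "norm f"] h(3) by (simp add: h(2)[OF K(2)] \<pi>(2))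
  qed
  ultimately show thesis using that r by blast
qed

section \<open>Limit measures of orbits\<close>

lemma tendsto_if_in_shrinking_balls:
  fixes u :: "nat \<Rightarrow> 'b::metric_space"
  assumes "\<And>j. u j \<in> ball y (inverse (real (Suc j)))"
  shows "u \<longlonglongrightarrow> y"
proof (rule metric_tendsto_imp_tendsto[OF LIMSEQ_inverse_real_of_nat])
  show "\<forall>\<^sub>F j in sequentially. dist (u j) y \<le> dist (inverse (real (Suc j))) 0"
    using assms by (intro always_eventually) (auto simp: dist_commute less_imp_le simp del: of_nat_Suc)
qed

text \<open>Positive indices are requested because the empirical measure of length zero is not a
probability measure.\<close>

lemma frequently_diagonal_subseq:
  fixes P :: "nat \<Rightarrow> nat \<Rightarrow> bool"
  assumes "\<And>j. \<exists>\<^sub>F n in sequentially. P j n"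
  shows "\<exists>r :: nat \<Rightarrow> nat. strict_mono r \<and> (\<forall>j. 0 < r j) \<and> (\<forall>j. P j (r j))"
proof -
  have ex: "\<exists>n>k. P j n" for j k
    using assms[of j] unfolding frequently_sequentially by (meson Suc_le_eq)
  have "\<exists>r. \<forall>j. (0 < r j \<and> P j (r j)) \<and> r j < r (Suc j)"
  proof (rule dependent_nat_choice)
    show "\<exists>n. 0 < n \<and> P 0 n" using ex by blast
    show "\<exists>n'. (0 < n' \<and> P (Suc j) n') \<and> n < n'" if "0 < n \<and> P j n" for n j
    proof -
      obtain n' where "n < n'" "P (Suc j) n'" using ex[of n "Suc j"] by blast
      then show ?thesis using that by (intro exI[of _ n']) simp
    qed
  qed
  then obtain r where "\<forall>j. (0 < r j \<and> P j (r j)) \<and> r j < r (Suc j)" by blast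
  then show ?thesis by (intro exI[of _ r]) (simp add: strict_mono_Suc_iff)
qed

lemma eventually_subseq_imp_frequently:
  fixes r :: "nat \<Rightarrow> nat"
  assumes "strict_mono r" "\<forall>\<^sub>F k in sequentially. P (r k)"
  shows "\<exists>\<^sub>F n in sequentially. P n"
proof -
  obtain K where K: "\<And>k. k \<ge> K \<Longrightarrow> P (r k)" using assms(2) unfolding eventually_sequentially by blast
  have "\<exists>n\<ge>N. P n" for N
    using K[of "max K N"] seq_suble[OF assms(1), of "max K N"] by (intro exI[of _ "r (max K N)"]) auto
  then show ?thesis unfolding frequently_sequentially by blast
qed

lemma cluster_point_subseq:
  fixes u :: "nat \<Rightarrow> 'b::metric_space"
  assumes cl: "\<And>U. open U \<Longrightarrow> y \<in> U \<Longrightarrow> \<exists>\<^sub>F n in sequentially. u n \<in> U"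
  shows "\<exists>r :: nat \<Rightarrow> nat. strict_mono r \<and> (\<forall>k. 0 < r k) \<and> (\<lambda>k. u (r k)) \<longlonglongrightarrow> y"
proof -
  have "\<exists>\<^sub>F n in sequentially. u n \<in> ball y (inverse (real (Suc j)))" for j
    by (rule cl) auto
  then obtain r where r: "strict_mono r" "\<forall>j. 0 < r j" "\<forall>j. u (r j) \<in> ball y (inverse (real (Suc j)))"
    using frequently_diagonal_subseq[of "\<lambda>j n. u n \<in> ball y (inverse (real (Suc j)))"] by blast
  have "(\<lambda>j. u (r j)) \<longlonglongrightarrow> y" using r(3) by (intro tendsto_if_in_shrinking_balls) blast
  then show ?thesis using r(1,2) by blast
qed

lemma tendsto_fun_iff:
  fixes u :: "'c \<Rightarrow> 'i \<Rightarrow> 'b::topological_space"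
  shows "(u \<longlongrightarrow> l) F \<longleftrightarrow> (\<forall>i. ((\<lambda>k. u k i) \<longlongrightarrow> l i) F)"
  using limitin_componentwise[of "\<lambda>_. euclidean" UNIV u l F]
  by (simp add: euclidean_product_topology extensional_def)

lemma integral_empirical:
  fixes f :: "'a::topological_space \<Rightarrow>\<^sub>C real"
  shows "(LINT y|empirical T x n. f y) = (\<Sum>i<n. f ((T ^^ i) x)) / real n"
proof -
  have "(LINT y|empirical T x n. f y) = (LINT i|uniform_count_measure {..<n}. f ((T ^^ i) x))"
    unfolding empirical_def
    by (rule integral_distr[OF _ borel_measurable_bcontfun]) (auto simp: measurable_def)
  also have "\<dots> = (\<Sum>i<n. f ((T ^^ i) x)) / real n"
    by (simp add: integral_uniform_count_measure)
  finally show ?thesis .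
qed

lemma empirical_prob_measures:
  assumes "0 < n"
  shows "empirical T x n \<in> prob_measures"
proof -
  have "prob_space (uniform_count_measure {..<n})"
    using assms by (intro prob_space_uniform_count_measure) auto
  then have "prob_space (empirical T x n)"
    unfolding empirical_def by (rule prob_space.prob_space_distr) (auto simp: measurable_def)
  then show ?thesis unfolding prob_measures_def empirical_def by simp
qed

lemma topspace_weak_star: "topspace weak_star = (prob_measures :: 'a::topological_space measure set)"
proof -
  have "(prob_measures :: 'a measure set) \<in> {{\<mu> \<in> prob_measures. (LINT x|\<mu>. apply_bcontfun f x) \<in> U} | (f :: 'a \<Rightarrow>\<^sub>C real) U. open U}"
    by (rule CollectI, rule exI[of _ 0], rule exI[of _ UNIV]) simp
  then show ?thesis unfolding weak_star_def by (auto simp: topology_generated_by_topspace)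
qed

lemma continuous_map_weak_star_integral:
  "continuous_map weak_star euclidean (\<lambda>\<mu>. LINT x|\<mu>. apply_bcontfun f x)"
  for f :: "'a::topological_space \<Rightarrow>\<^sub>C real"
  unfolding continuous_map_def
proof (intro conjI allI impI)
  fix U :: "real set" assume "openin euclidean U"
  then have "{\<mu> \<in> prob_measures. (LINT x|\<mu>. apply_bcontfun f x) \<in> U} \<in>
    {{\<mu> \<in> prob_measures. (LINT x|\<mu>. apply_bcontfun f x) \<in> U} | (f :: 'a \<Rightarrow>\<^sub>C real) U. open U}"
    by auto
  then show "openin weak_star {\<mu> \<in> topspace weak_star. (LINT x|\<mu>. apply_bcontfun f x) \<in> U}"
    unfolding topspace_weak_star unfolding weak_star_def by (rule topology_generated_by_Basis)
qed simp

text \<open>The sets that, if they contain \<open>\<mu>\<close>, eventually contain the empirical measures of the subsequence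
are stable under finite intersections and arbitrary unions, so it suffices to look at the generating
sets of the weak* topology.\<close>

lemma limit_measuresI:
  assumes \<mu>: "\<mu> \<in> prob_measures" and r: "strict_mono r" "\<And>k. 0 < r k"
    and lim: "\<And>f :: 'a::topological_space \<Rightarrow>\<^sub>C real. (\<lambda>k. LINT y|empirical T x (r k). f y) \<longlonglongrightarrow> (LINT y|\<mu>. f y)"
  shows "\<mu> \<in> limit_measures T x"
proof -
  have ev: "\<mu> \<in> W \<longrightarrow> (\<forall>\<^sub>F k in sequentially. empirical T x (r k) \<in> W)"
    if "generate_topology_on {{\<mu> \<in> prob_measures. (LINT x|\<mu>. apply_bcontfun f x) \<in> U} | (f :: 'a \<Rightarrow>\<^sub>C real) U. open U} W" for W
    using that
  proof induction
    case (Int a b)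
    then show ?case by (auto intro: eventually_conj)
  next
    case (UN K)
    show ?case
    proof
      assume "\<mu> \<in> \<Union>K"
      then obtain k where k: "k \<in> K" "\<mu> \<in> k" by blast
      then have "\<forall>\<^sub>F i in sequentially. empirical T x (r i) \<in> k" using UN by blast
      then show "\<forall>\<^sub>F i in sequentially. empirical T x (r i) \<in> \<Union>K"
        by eventually_elim (use k(1) in blast)
    qed
  next
    case (Basis s)
    then obtain f :: "'a \<Rightarrow>\<^sub>C real" and U where s: "s = {\<mu> \<in> prob_measures. (LINT x|\<mu>. apply_bcontfun f x) \<in> U}" "open U"
      by blast
    show ?case
    proof
      assume "\<mu> \<in> s"
      then have "\<forall>\<^sub>F k in sequentially. (LINT y|empirical T x (r k). f y) \<in> U"
        using topological_tendstoD[OF lim[of f] s(2)] s(1) by simp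
      then show "\<forall>\<^sub>F k in sequentially. empirical T x (r k) \<in> s"
        by eventually_elim (simp add: s(1) empirical_prob_measures r(2))
    qed
  qed simp
  show ?thesis unfolding limit_measures_def
  proof (intro CollectI conjI \<mu> allI impI, elim conjE)
    fix W assume "openin weak_star W" "\<mu> \<in> W"
    then have "\<forall>\<^sub>F k in sequentially. empirical T x (r k) \<in> W"
      using ev openin_topology_generated_by unfolding weak_star_def by blast
    then show "\<exists>\<^sub>F n in sequentially. empirical T x n \<in> W"
      by (rule eventually_subseq_imp_frequently[OF r(1)])
  qed
qed

text \<open>The coordinates of a measure with respect to a sequence of test functions. If the sequence is
uniformly dense, they turn the weak* topology on probability measures into the product topology on
real sequences, which is metrizable and has a countable base.\<close>

definition moments :: "(nat \<Rightarrow> 'a::topological_space \<Rightarrow>\<^sub>C real) \<Rightarrow> 'a measure \<Rightarrow> nat \<Rightarrow> real" where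
  "moments g \<mu> = (\<lambda>i. LINT x|\<mu>. g i x)"

text \<open>The moments depend continuously on the measure in the weak* topology.\<close>

lemma frequently_moments_empirical:
  assumes \<mu>: "\<mu> \<in> limit_measures T x" and U: "open U" "moments g \<mu> \<in> U"
  shows "\<exists>\<^sub>F n in sequentially. moments g (empirical T x n) \<in> U"
proof -
  have "continuous_map weak_star (product_topology (\<lambda>_. euclidean) UNIV) (moments g)"
    unfolding continuous_map_componentwise_UNIV moments_def
    by (intro allI continuous_map_weak_star_integral)
  then have "openin weak_star {\<nu> \<in> prob_measures. moments g \<nu> \<in> U}"
    using U(1) unfolding continuous_map_def euclidean_product_topology topspace_weak_star by auto
  moreover have "\<mu> \<in> {\<nu> \<in> prob_measures. moments g \<nu> \<in> U}"
    using \<mu> U(2) unfolding limit_measures_def by blast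
  ultimately have "\<exists>\<^sub>F n in sequentially. empirical T x n \<in> {\<nu> \<in> prob_measures. moments g \<nu> \<in> U}"
    using \<mu> unfolding limit_measures_def by blast
  then show ?thesis by (rule frequently_elim1) simp
qed

locale dense_tests =
  fixes g :: "nat \<Rightarrow> 'a::metric_space \<Rightarrow>\<^sub>C real"
  assumes compact_space: "compact (UNIV :: 'a set)"
    and dense: "\<And>(f :: 'a \<Rightarrow>\<^sub>C real) e. 0 < e \<Longrightarrow> \<exists>i. \<forall>x. dist (f x) (g i x) < e"
begin

lemma integral_tendsto_if_moments_tendsto:
  fixes f :: "'a \<Rightarrow>\<^sub>C real"
  assumes M: "\<And>k. M k \<in> prob_measures" "\<mu> \<in> prob_measures"
    and lim: "(\<lambda>k. moments g (M k)) \<longlonglongrightarrow> moments g \<mu>"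
  shows "(\<lambda>k. LINT x|M k. f x) \<longlonglongrightarrow> (LINT x|\<mu>. f x)"
proof (rule tendstoI)
  fix e :: real assume "0 < e"
  then obtain i where i: "\<And>x. dist (f x) (g i x) < e / 3" using dense[of "e / 3" f] by auto
  then have le: "\<bar>f x - g i x\<bar> \<le> e / 3" for x by (simp add: dist_real_def less_imp_le)
  have "(\<lambda>k. LINT x|M k. g i x) \<longlonglongrightarrow> (LINT x|\<mu>. g i x)"
    using lim unfolding tendsto_fun_iff moments_def by blast
  then have "\<forall>\<^sub>F k in sequentially. dist (LINT x|M k. g i x) (LINT x|\<mu>. g i x) < e / 3"
    using \<open>0 < e\<close> by (intro tendstoD) auto
  then show "\<forall>\<^sub>F k in sequentially. dist (LINT x|M k. f x) (LINT x|\<mu>. f x) < e"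
  proof eventually_elim
    case (elim k)
    then show ?case
      using abs_integral_bcontfun_diff_le[OF M(1) le, of k] abs_integral_bcontfun_diff_le[OF M(2) le]
      unfolding dist_real_def by linarith
  qed
qed

lemma limit_measures_iff_moments:
  "\<mu> \<in> limit_measures T x \<longleftrightarrow> \<mu> \<in> prob_measures \<and>
    (\<forall>U. open U \<and> moments g \<mu> \<in> U \<longrightarrow> (\<exists>\<^sub>F n in sequentially. moments g (empirical T x n) \<in> U))"
  (is "_ \<longleftrightarrow> ?R") for T :: "'a \<Rightarrow> 'a"
proof
  assume \<mu>: "\<mu> \<in> limit_measures T x"
  then have "\<mu> \<in> prob_measures" by (simp add: limit_measures_def)
  then show ?R by (simp add: frequently_moments_empirical[OF \<mu>])
next
  assume R: ?R
  then obtain r where r: "strict_mono r" "\<And>k. 0 < r k"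
    and lim: "(\<lambda>k. moments g (empirical T x (r k))) \<longlonglongrightarrow> moments g \<mu>"
    using cluster_point_subseq[of "moments g \<mu>" "\<lambda>n. moments g (empirical T x n)"] by blast
  show "\<mu> \<in> limit_measures T x"
    by (rule limit_measuresI[OF _ r(1,2)])
       (use R integral_tendsto_if_moments_tendsto[OF _ _ lim] empirical_prob_measures[OF r(2)] in blast)+
qed

lemma limit_measuresE:
  fixes T :: "'a \<Rightarrow> 'a"
  assumes "\<mu> \<in> limit_measures T x"
  obtains r where "strict_mono r" "\<And>k. 0 < r k"
    "\<And>f :: 'a \<Rightarrow>\<^sub>C real. (\<lambda>k. LINT y|empirical T x (r k). f y) \<longlonglongrightarrow> (LINT y|\<mu>. f y)"
proof -
  have \<mu>: "\<mu> \<in> prob_measures" using assms unfolding limit_measures_def by blast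
  obtain r where r: "strict_mono r" "\<And>k. 0 < r k"
    and lim: "(\<lambda>k. moments g (empirical T x (r k))) \<longlonglongrightarrow> moments g \<mu>"
    using cluster_point_subseq[of "moments g \<mu>" "\<lambda>n. moments g (empirical T x n)",
        OF frequently_moments_empirical[OF assms]] by blast
  show thesis
    by (rule that[OF r(1,2)], rule integral_tendsto_if_moments_tendsto[OF empirical_prob_measures[OF r(2)] \<mu> lim])
qed

lemma limit_measures_compactness:
  fixes s :: "nat \<Rightarrow> nat" and T :: "'a \<Rightarrow> 'a"
  assumes s: "strict_mono s" "\<And>k. 0 < s k"
  obtains r \<mu> where "strict_mono r" "\<mu> \<in> limit_measures T x"
    "\<And>f :: 'a \<Rightarrow>\<^sub>C real. (\<lambda>k. LINT y|empirical T x (s (r k)). f y) \<longlonglongrightarrow> (LINT y|\<mu>. f y)"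
proof -
  obtain r :: "nat \<Rightarrow> nat" and \<mu> where r: "strict_mono r" "\<mu> \<in> prob_measures"
    "\<And>f :: 'a \<Rightarrow>\<^sub>C real. (\<lambda>k. LINT y|empirical T x (s (r k)). f y) \<longlonglongrightarrow> (LINT y|\<mu>. f y)"
    using prob_measures_seq_compact[OF compact_space, of "\<lambda>k. empirical T x (s k)", OF empirical_prob_measures[OF s(2)]]
    by metis
  have "\<mu> \<in> limit_measures T x"
    by (rule limit_measuresI[OF r(2), of "\<lambda>k. s (r k)"])
       (use r s strict_mono_compose[OF s(1) r(1)] in auto)
  then show thesis using that r by blast
qed

lemma limit_measures_nonempty: "limit_measures T x \<noteq> {}" for T :: "'a \<Rightarrow> 'a"
proof -
  have "strict_mono Suc" by (simp add: strict_mono_def)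
  then obtain \<mu> where "\<mu> \<in> limit_measures T x" by (rule limit_measures_compactness) simp
  then show ?thesis by blast
qed

text \<open>Along \<open>x\<close> and along \<open>T x\<close> the averages of \<open>f\<close> over \<open>n\<close> steps differ by
\<open>(f (T\<^sup>n x) - f x) / n\<close>, which tends to zero.\<close>

lemma limit_measures_shift: "limit_measures T (T x) = limit_measures T x" for T :: "'a \<Rightarrow> 'a"
proof -
  have diff: "(\<lambda>k. (LINT y|empirical T (T x) (r k). f y) - (LINT y|empirical T x (r k). f y)) \<longlonglongrightarrow> 0"
    if r: "strict_mono r" for r and f :: "'a \<Rightarrow>\<^sub>C real"
  proof -
    have eq: "(LINT y|empirical T (T x) n. f y) - (LINT y|empirical T x n. f y) = (f ((T ^^ n) x) - f x) / real n" for n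
    proof -
      have "(\<Sum>i<n. f ((T ^^ i) (T x))) + f x = (\<Sum>i<n. f ((T ^^ i) x)) + f ((T ^^ n) x)"
        by (induction n) (auto simp: funpow_swap1)
      then show ?thesis unfolding integral_empirical by (simp add: diff_divide_distrib[symmetric])
    qed
    have "(\<lambda>n. (f ((T ^^ n) x) - f x) / real n) \<longlonglongrightarrow> 0"
    proof (rule tendsto_rabs_zero_cancel, rule tendsto_sandwich[where f = "\<lambda>_. 0" and h = "\<lambda>n. (2 * norm f) / real n"])
      have "\<bar>f ((T ^^ n) x) - f x\<bar> \<le> 2 * norm f" for n
        using norm_bounded[of f "(T ^^ n) x"] norm_bounded[of f x] by simp
      then show "\<forall>\<^sub>F n in sequentially. \<bar>(f ((T ^^ n) x) - f x) / real n\<bar> \<le> (2 * norm f) / real n"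
        by (intro always_eventually allI) (simp add: abs_divide divide_right_mono)
      show "(\<lambda>n. (2 * norm f) / real n) \<longlonglongrightarrow> 0" by (rule lim_const_over_n)
    qed auto
    from LIMSEQ_subseq_LIMSEQ[OF this r] show ?thesis by (simp add: eq o_def)
  qed
  have "\<mu> \<in> limit_measures T (T x)" if \<mu>: "\<mu> \<in> limit_measures T x" for \<mu>
  proof -
    obtain r where r: "strict_mono r" "\<And>k. 0 < r k"
      "\<And>f :: 'a \<Rightarrow>\<^sub>C real. (\<lambda>k. LINT y|empirical T x (r k). f y) \<longlonglongrightarrow> (LINT y|\<mu>. f y)"
      using limit_measuresE[OF \<mu>] by metis
    have "(\<lambda>k. LINT y|empirical T (T x) (r k). f y) \<longlonglongrightarrow> (LINT y|\<mu>. f y)" for f :: "'a \<Rightarrow>\<^sub>C real"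
      using tendsto_add[OF diff[OF r(1), of f] r(3)[of f]] by simp
    moreover have "\<mu> \<in> prob_measures" using \<mu> unfolding limit_measures_def by blast
    ultimately show ?thesis by (intro limit_measuresI[OF _ r(1,2)])
  qed
  moreover have "\<mu> \<in> limit_measures T x" if \<mu>: "\<mu> \<in> limit_measures T (T x)" for \<mu>
  proof -
    obtain r where r: "strict_mono r" "\<And>k. 0 < r k"
      "\<And>f :: 'a \<Rightarrow>\<^sub>C real. (\<lambda>k. LINT y|empirical T (T x) (r k). f y) \<longlonglongrightarrow> (LINT y|\<mu>. f y)"
      using limit_measuresE[OF \<mu>] by metis
    have "(\<lambda>k. LINT y|empirical T x (r k). f y) \<longlonglongrightarrow> (LINT y|\<mu>. f y)" for f :: "'a \<Rightarrow>\<^sub>C real"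
      using tendsto_diff[OF r(3)[of f] diff[OF r(1), of f]] by simp
    moreover have "\<mu> \<in> prob_measures" using \<mu> unfolding limit_measures_def by blast
    ultimately show ?thesis by (intro limit_measuresI[OF _ r(1,2)])
  qed
  ultimately show ?thesis by blast
qed

lemma limit_measures_funpow: "limit_measures T ((T ^^ k) x) = limit_measures T x" for T :: "'a \<Rightarrow> 'a"
  by (induction k) (auto simp: limit_measures_shift)

lemma continuous_on_integral_empirical:
  fixes T :: "'a \<Rightarrow> 'a" and f :: "'a \<Rightarrow>\<^sub>C real"
  assumes T: "continuous_on UNIV T"
  shows "continuous_on UNIV (\<lambda>x. LINT y|empirical T x n. f y)"
proof (cases "n = 0")
  case False
  have "continuous_on UNIV (\<lambda>x. f ((T ^^ i) x))" for i
    using continuous_on_compose2[OF continuous_on_apply_bcontfun continuous_on_funpow[OF T]] by blast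
  then show ?thesis unfolding integral_empirical using False by (intro continuous_intros) auto
qed (simp add: integral_empirical)

lemma open_vimage_moments_empirical:
  fixes T :: "'a \<Rightarrow> 'a"
  assumes T: "continuous_on UNIV T" and U: "open U"
  shows "open {x. moments g (empirical T x n) \<in> U}"
proof -
  have "continuous_on UNIV (\<lambda>x. moments g (empirical T x n))"
    unfolding moments_def by (intro continuous_on_coordinatewise_then_product continuous_on_integral_empirical T)
  from open_vimage[OF U this] show ?thesis by (simp add: vimage_def)
qed

section \<open>Limit measures of a generic point\<close>

text \<open>For a member \<open>b\<close> of a countable base that contains the moments of a limit measure of some transitive
point \<open>y\<close>, the empirical measures of every iterate of \<open>y\<close> enter \<open>b\<close> infinitely often, since \<open>y\<close> and
its iterates have the same limit measures. Hence those of a generic point do, simultaneously for all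
such \<open>b\<close>.\<close>

theorem residual_limit_measures_eq_M_Trans:
  fixes T :: "'a \<Rightarrow> 'a"
  assumes T: "continuous_on UNIV T" and tr: "transitive_system T"
  shows "residual {x \<in> Trans T. limit_measures T x = M_Trans T}"
proof -
  obtain B :: "(nat \<Rightarrow> real) set set" where B: "countable B" "topological_basis B"
    using ex_countable_basis by blast
  have opn: "open b" if "b \<in> B" for b using topological_basis_open[OF B(2) that] .
  define S where "S b = (if \<exists>\<mu>\<in>M_Trans T. moments g \<mu> \<in> b
      then {x. \<exists>\<^sub>F n in sequentially. moments g (empirical T x n) \<in> b} else UNIV)" for b
  have "residual (S b)" if b: "b \<in> B" for b
  proof (cases "\<exists>\<mu>\<in>M_Trans T. moments g \<mu> \<in> b")
    case True
    then obtain y \<mu> where y: "y \<in> Trans T" "\<mu> \<in> limit_measures T y" "moments g \<mu> \<in> b"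
      unfolding M_Trans_def by blast
    have "residual {x. \<exists>\<^sub>F n in sequentially. x \<in> {x. moments g (empirical T x n) \<in> b}}"
    proof (rule residual_frequently_open[OF compact_space open_vimage_moments_empirical[OF T opn[OF b]]])
      fix U :: "'a set" assume "open U" "U \<noteq> {}"
      then obtain k where k: "(T ^^ k) y \<in> U" using Trans_hits[OF y(1)] by blast
      have "\<mu> \<in> limit_measures T ((T ^^ k) y)" using y(2) by (simp add: limit_measures_funpow)
      then have "\<exists>\<^sub>F n in sequentially. (T ^^ k) y \<in> {x. moments g (empirical T x n) \<in> b}"
        using frequently_moments_empirical[OF _ opn[OF b] y(3)] by simp
      then show "\<exists>z\<in>U. \<exists>\<^sub>F n in sequentially. z \<in> {x. moments g (empirical T x n) \<in> b}"
        using k by blast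
    qed
    then show ?thesis unfolding S_def using True by simp
  next
    case False
    then show ?thesis
      unfolding S_def if_not_P[OF False] using residual_mono[OF residual_Trans[OF compact_space T tr]] by simp
  qed
  then have "residual (Trans T \<inter> (\<Inter>b\<in>B. S b))"
    by (intro residual_Int residual_INT_countable compact_space residual_Trans T tr B(1))
  moreover have "limit_measures T x = M_Trans T" if x: "x \<in> Trans T" "x \<in> (\<Inter>b\<in>B. S b)" for x
  proof
    show "limit_measures T x \<subseteq> M_Trans T" unfolding M_Trans_def using x(1) by blast
    show "M_Trans T \<subseteq> limit_measures T x"
    proof
      fix \<mu> assume \<mu>: "\<mu> \<in> M_Trans T"
      then have "\<mu> \<in> prob_measures" unfolding M_Trans_def limit_measures_def by blast
      moreover have "\<exists>\<^sub>F n in sequentially. moments g (empirical T x n) \<in> U" if U: "open U" "moments g \<mu> \<in> U" for U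
      proof -
        obtain b where b: "b \<in> B" "moments g \<mu> \<in> b" "b \<subseteq> U" using topological_basisE[OF B(2) U] by metis
        have "x \<in> S b" using x(2) b(1) by blast
        moreover have "\<exists>\<mu>\<in>M_Trans T. moments g \<mu> \<in> b" using \<mu> b(2) by blast
        ultimately have "x \<in> {x. \<exists>\<^sub>F n in sequentially. moments g (empirical T x n) \<in> b}"
          unfolding S_def by simp
        then show ?thesis using b(3) by (auto elim: frequently_elim1)
      qed
      ultimately show "\<mu> \<in> limit_measures T x" unfolding limit_measures_iff_moments by blast
    qed
  qed
  ultimately show ?thesis by (elim residual_mono) blast
qed

end

section \<open>Physical-like measures\<close>

lemma norm_rho_term_le:
  fixes F :: "nat \<Rightarrow> 'a::topological_space \<Rightarrow>\<^sub>C real"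
  assumes F: "\<And>i. norm (F i) \<le> 1" and "\<mu> \<in> prob_measures" "\<nu> \<in> prob_measures"
  shows "norm ((1/2) ^ Suc i * \<bar>(LINT x|\<mu>. apply_bcontfun (F i) x) - (LINT x|\<nu>. apply_bcontfun (F i) x)\<bar>) \<le> (1/2) ^ i"
proof -
  have "\<bar>(LINT x|\<mu>. F i x) - (LINT x|\<nu>. F i x)\<bar> \<le> 2"
    using abs_integral_bcontfun_le[OF assms(2), of "F i"] abs_integral_bcontfun_le[OF assms(3), of "F i"] F[of i]
    by linarith
  from mult_left_mono[OF this, of "(1/2) ^ Suc i"] show ?thesis by (simp add: abs_mult)
qed

lemma rho_nonneg:
  fixes F :: "nat \<Rightarrow> 'a::topological_space \<Rightarrow>\<^sub>C real"
  assumes F: "\<And>i. norm (F i) \<le> 1" and "\<mu> \<in> prob_measures" "\<nu> \<in> prob_measures"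
  shows "0 \<le> rho F \<mu> \<nu>"
  unfolding rho_def
proof (rule suminf_nonneg)
  show "summable (\<lambda>i. (1/2) ^ Suc i * \<bar>(LINT x|\<mu>. apply_bcontfun (F i) x) - (LINT x|\<nu>. apply_bcontfun (F i) x)\<bar>)"
    by (rule summable_comparison_test'[where N = 0, OF summable_geometric norm_rho_term_le[OF assms]]) simp
qed simp

text \<open>The terms of the series are dominated by \<open>2^-i\<close>, so the limit may be taken termwise.\<close>

lemma rho_tendsto:
  fixes F :: "nat \<Rightarrow> 'a::topological_space \<Rightarrow>\<^sub>C real"
  assumes F: "\<And>i. norm (F i) \<le> 1" and \<mu>: "\<mu> \<in> prob_measures" and M: "\<And>k. M k \<in> prob_measures"
    and lim: "\<And>f :: 'a \<Rightarrow>\<^sub>C real. (\<lambda>k. LINT x|M k. f x) \<longlonglongrightarrow> (LINT x|\<nu>. f x)"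
  shows "(\<lambda>k. rho F \<mu> (M k)) \<longlonglongrightarrow> rho F \<mu> \<nu>"
  unfolding rho_def
proof (rule tannerys_theorem[where M = "\<lambda>i. (1/2) ^ i", THEN conjunct2, THEN conjunct2])
  show "(\<lambda>k. (1/2) ^ Suc i * \<bar>(LINT x|\<mu>. F i x) - (LINT x|M k. F i x)\<bar>)
      \<longlonglongrightarrow> (1/2) ^ Suc i * \<bar>(LINT x|\<mu>. F i x) - (LINT x|\<nu>. F i x)\<bar>" for i
    by (intro tendsto_intros lim)
  show "\<forall>\<^sub>F (i, k) in at_top \<times>\<^sub>F sequentially.
      norm ((1/2) ^ Suc i * \<bar>(LINT x|\<mu>. F i x) - (LINT x|M k. F i x)\<bar>) \<le> (1/2) ^ i"
    by (intro always_eventually allI) (use norm_rho_term_le[OF F \<mu> M] in auto)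
qed (auto intro: summable_geometric)

lemma rho_self: "rho F \<mu> \<mu> = 0"
  unfolding rho_def by simp

context dense_tests
begin

text \<open>By compactness the distance from \<open>\<mu>\<close> to the set of limit measures is the lower limit of the
distances to the empirical measures. The right-hand side involves only countably many measurable
functions of \<open>z\<close>, which makes the set of these \<open>z\<close> measurable.\<close>

lemma INF_rho_le_iff:
  fixes T :: "'a \<Rightarrow> 'a" and F :: "nat \<Rightarrow> 'a \<Rightarrow>\<^sub>C real"
  assumes F: "\<And>i. norm (F i) \<le> 1" and \<mu>: "\<mu> \<in> prob_measures"
  shows "(INF \<nu>\<in>limit_measures T z. rho F \<mu> \<nu>) \<le> \<epsilon> \<longleftrightarrow>
    (\<forall>k. \<exists>\<^sub>F n in sequentially. rho F \<mu> (empirical T z n) < \<epsilon> + inverse (real (Suc k)))"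
proof -
  have V: "\<nu> \<in> prob_measures" if "\<nu> \<in> limit_measures T z" for \<nu> using that unfolding limit_measures_def by blast
  have bdd: "bdd_below (rho F \<mu> ` limit_measures T z)"
    using rho_nonneg[OF F \<mu> V] by (intro bdd_belowI[of _ 0]) auto
  show ?thesis
  proof
    assume le: "(INF \<nu>\<in>limit_measures T z. rho F \<mu> \<nu>) \<le> \<epsilon>"
    show "\<forall>k. \<exists>\<^sub>F n in sequentially. rho F \<mu> (empirical T z n) < \<epsilon> + inverse (real (Suc k))"
    proof
      fix k
      have "0 < inverse (real (Suc k))" by simp
      then have "(INF \<nu>\<in>limit_measures T z. rho F \<mu> \<nu>) < \<epsilon> + inverse (real (Suc k))" using le by linarith
      then obtain \<nu> where \<nu>: "\<nu> \<in> limit_measures T z" "rho F \<mu> \<nu> < \<epsilon> + inverse (real (Suc k))"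
        using cINF_less_iff[OF limit_measures_nonempty bdd] by blast
      obtain r where r: "strict_mono r" "\<And>k. 0 < r k"
        "\<And>f :: 'a \<Rightarrow>\<^sub>C real. (\<lambda>k. LINT y|empirical T z (r k). f y) \<longlonglongrightarrow> (LINT y|\<nu>. f y)"
        using limit_measuresE[OF \<nu>(1)] by metis
      have "(\<lambda>k. rho F \<mu> (empirical T z (r k))) \<longlonglongrightarrow> rho F \<mu> \<nu>"
        by (rule rho_tendsto[OF F \<mu> empirical_prob_measures[OF r(2)] r(3)])
      then have "\<forall>\<^sub>F j in sequentially. rho F \<mu> (empirical T z (r j)) < \<epsilon> + inverse (real (Suc k))"
        using \<nu>(2) by (rule order_tendstoD(2))
      then show "\<exists>\<^sub>F n in sequentially. rho F \<mu> (empirical T z n) < \<epsilon> + inverse (real (Suc k))"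
        by (rule eventually_subseq_imp_frequently[OF r(1)])
    qed
  next
    assume freq: "\<forall>k. \<exists>\<^sub>F n in sequentially. rho F \<mu> (empirical T z n) < \<epsilon> + inverse (real (Suc k))"
    have "(INF \<nu>\<in>limit_measures T z. rho F \<mu> \<nu>) \<le> \<epsilon> + inverse (real (Suc k))" for k
    proof -
      define \<delta> where "\<delta> = \<epsilon> + inverse (real (Suc k))"
      have "\<exists>\<^sub>F n in sequentially. rho F \<mu> (empirical T z n) < \<delta>" using freq unfolding \<delta>_def by blast
      then obtain s :: "nat \<Rightarrow> nat" where s: "strict_mono s" "\<And>j. 0 < s j"
        "\<And>j. rho F \<mu> (empirical T z (s j)) < \<delta>"
        using frequently_diagonal_subseq[of "\<lambda>_ n. rho F \<mu> (empirical T z n) < \<delta>"] by auto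
      obtain r \<nu> where r: "strict_mono r" "\<nu> \<in> limit_measures T z"
        "\<And>f :: 'a \<Rightarrow>\<^sub>C real. (\<lambda>k. LINT y|empirical T z (s (r k)). f y) \<longlonglongrightarrow> (LINT y|\<nu>. f y)"
        using limit_measures_compactness[OF s(1,2), of T z] by metis
      have "(\<lambda>k. rho F \<mu> (empirical T z (s (r k)))) \<longlonglongrightarrow> rho F \<mu> \<nu>"
        by (rule rho_tendsto[OF F \<mu> empirical_prob_measures[OF s(2)] r(3)])
      then have "rho F \<mu> \<nu> \<le> \<delta>"
        by (rule LIMSEQ_le_const2) (use s(3) in \<open>auto intro: less_imp_le\<close>)
      then show ?thesis unfolding \<delta>_def by (rule cINF_lower2[OF bdd r(2)])
    qed
    note le = this
    have "(INF \<nu>\<in>limit_measures T z. rho F \<mu> \<nu>) \<le> \<epsilon> + e" if e: "0 < e" for e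
    proof -
      obtain k where "inverse (real (Suc k)) < e" using reals_Archimedean[OF e] by blast
      then show ?thesis using le[of k] by linarith
    qed
    then show "(INF \<nu>\<in>limit_measures T z. rho F \<mu> \<nu>) \<le> \<epsilon>" by (rule field_le_epsilon)
  qed
qed

lemma sets_INF_rho_le:
  fixes T :: "'a \<Rightarrow> 'a" and F :: "nat \<Rightarrow> 'a \<Rightarrow>\<^sub>C real"
  assumes F: "\<And>i. norm (F i) \<le> 1" and \<mu>: "\<mu> \<in> prob_measures" and T: "continuous_on UNIV T"
  shows "{z. (INF \<nu>\<in>limit_measures T z. rho F \<mu> \<nu>) \<le> \<epsilon>} \<in> sets borel"
proof -
  have "(\<lambda>z. LINT y|empirical T z n. F i y) \<in> borel_measurable borel" for n i
    by (intro borel_measurable_continuous_onI continuous_on_integral_empirical T)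
  then have [measurable]: "(\<lambda>z. rho F \<mu> (empirical T z n)) \<in> borel_measurable borel" for n
    unfolding rho_def by measurable
  have "{z. (INF \<nu>\<in>limit_measures T z. rho F \<mu> \<nu>) \<le> \<epsilon>} =
    (\<Inter>k. \<Inter>N. \<Union>n\<in>{N..}. {z \<in> space borel. rho F \<mu> (empirical T z n) < \<epsilon> + inverse (real (Suc k))})"
    unfolding INF_rho_le_iff[OF F \<mu>] frequently_sequentially by auto
  also have "\<dots> \<in> sets borel" by measurable
  finally show ?thesis .
qed

text \<open>Otherwise there would be measures whose moments converge to those of \<open>\<mu>\<close> while their distance
from \<open>\<mu>\<close> stays above \<open>\<epsilon>\<close>, against the continuity of the distance.\<close>

lemma weak_neighborhood_rho:
  fixes F :: "nat \<Rightarrow> 'a \<Rightarrow>\<^sub>C real"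
  assumes F: "\<And>i. norm (F i) \<le> 1" and \<mu>: "\<mu> \<in> prob_measures" and \<epsilon>: "0 < \<epsilon>"
  shows "\<exists>U. open U \<and> moments g \<mu> \<in> U \<and> (\<forall>\<nu>\<in>prob_measures. moments g \<nu> \<in> U \<longrightarrow> rho F \<mu> \<nu> < \<epsilon>)"
proof -
  have "\<exists>j. \<forall>\<nu>\<in>prob_measures. moments g \<nu> \<in> ball (moments g \<mu>) (inverse (real (Suc j))) \<longrightarrow> rho F \<mu> \<nu> < \<epsilon>"
  proof (rule ccontr)
    assume "\<not> ?thesis"
    then have "\<forall>j. \<exists>\<nu>. \<nu> \<in> prob_measures \<and> moments g \<nu> \<in> ball (moments g \<mu>) (inverse (real (Suc j))) \<and> \<epsilon> \<le> rho F \<mu> \<nu>"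
      by (metis not_less)
    then obtain N where N: "\<And>j. N j \<in> prob_measures"
      "\<And>j. moments g (N j) \<in> ball (moments g \<mu>) (inverse (real (Suc j)))" "\<And>j. \<epsilon> \<le> rho F \<mu> (N j)"
      by metis
    have lim: "(\<lambda>j. moments g (N j)) \<longlonglongrightarrow> moments g \<mu>"
      using N(2) by (rule tendsto_if_in_shrinking_balls)
    have "(\<lambda>j. rho F \<mu> (N j)) \<longlonglongrightarrow> rho F \<mu> \<mu>"
      by (rule rho_tendsto[OF F \<mu> N(1) integral_tendsto_if_moments_tendsto[OF N(1) \<mu> lim]])
    then have "\<epsilon> \<le> rho F \<mu> \<mu>" by (rule LIMSEQ_le_const) (use N(3) in auto)
    then show False using \<epsilon> by (simp add: rho_self)
  qed
  then obtain j where j: "\<forall>\<nu>\<in>prob_measures.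
      moments g \<nu> \<in> ball (moments g \<mu>) (inverse (real (Suc j))) \<longrightarrow> rho F \<mu> \<nu> < \<epsilon>"
    by blast
  show ?thesis
    by (rule exI[of _ "ball (moments g \<mu>) (inverse (real (Suc j)))"])
       (use j in \<open>simp del: of_nat_Suc\<close>)
qed

text \<open>Suppose that no measure in \<^term>\<open>M_Trans T\<close> is physical-like. Each of them then has a neighbourhood
in which almost every \<open>z\<close> has no limit measure. By the Lindeloef property the union \<open>N\<close> of all
such open sets is again of this kind. Limit measures exist, so almost every \<open>z\<close>, hence a dense
set of \<open>z\<close>, has a limit measure outside \<open>N\<close>. Therefore the empirical measures of a generic point \<open>x\<close>
come arbitrarily close to the closed complement of \<open>N\<close> infinitely often, and by compactness some limit
measure of \<open>x\<close> lies outside \<open>N\<close>. But the limit measures of a generic point are those in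
\<^term>\<open>M_Trans T\<close>, all of which lie in \<open>N\<close>.\<close>

theorem M_Trans_meets_physical_like:
  fixes T :: "'a \<Rightarrow> 'a" and F :: "nat \<Rightarrow> 'a \<Rightarrow>\<^sub>C real"
  assumes T: "continuous_on UNIV T" and tr: "transitive_system T"
    and F: "\<And>i. norm (F i) \<le> 1"
    and m: "sets m = sets borel" "\<And>U. open U \<Longrightarrow> U \<noteq> {} \<Longrightarrow> 0 < emeasure m U"
  shows "M_Trans T \<inter> physical_like T F m \<noteq> {}"
proof
  assume none: "M_Trans T \<inter> physical_like T F m = {}"
  define null_open where "null_open = {U :: (nat \<Rightarrow> real) set. open U \<and>
    (\<exists>Z\<in>null_sets m. {z. \<exists>\<nu>\<in>limit_measures T z. moments g \<nu> \<in> U} \<subseteq> Z)}"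
  define N where "N = \<Union>null_open"
  have "moments g \<mu> \<in> N" if \<mu>: "\<mu> \<in> M_Trans T" for \<mu>
  proof -
    have \<mu>p: "\<mu> \<in> prob_measures" using \<mu> unfolding M_Trans_def limit_measures_def by blast
    then obtain \<epsilon> where \<epsilon>: "0 < \<epsilon>" "\<not> emeasure m {z. (INF \<nu>\<in>limit_measures T z. rho F \<mu> \<nu>) \<le> \<epsilon>} > 0"
      using none \<mu> unfolding physical_like_def by blast
    let ?Z = "{z. (INF \<nu>\<in>limit_measures T z. rho F \<mu> \<nu>) \<le> \<epsilon>}"
    have Z: "?Z \<in> null_sets m"
      using \<epsilon>(2) sets_INF_rho_le[OF F \<mu>p T, where \<epsilon> = \<epsilon>] m(1) by (auto simp: null_sets_def)
    obtain U where U: "open U" "moments g \<mu> \<in> U"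
      "\<forall>\<nu>\<in>prob_measures. moments g \<nu> \<in> U \<longrightarrow> rho F \<mu> \<nu> < \<epsilon>"
      using weak_neighborhood_rho[where F = F, OF F \<mu>p \<epsilon>(1)] by (elim exE conjE)
    have "{z. \<exists>\<nu>\<in>limit_measures T z. moments g \<nu> \<in> U} \<subseteq> ?Z"
    proof (intro subsetI CollectI, elim CollectE bexE)
      fix z \<nu> assume \<nu>: "\<nu> \<in> limit_measures T z" "moments g \<nu> \<in> U"
      have V: "\<nu> \<in> prob_measures" if "\<nu> \<in> limit_measures T z" for \<nu> using that unfolding limit_measures_def by blast
      have bdd: "bdd_below (rho F \<mu> ` limit_measures T z)"
        using rho_nonneg[OF F \<mu>p V] by (intro bdd_belowI[of _ 0]) auto
      show "(INF \<nu>\<in>limit_measures T z. rho F \<mu> \<nu>) \<le> \<epsilon>"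
        using cINF_lower2[OF bdd \<nu>(1)] U(3) V[OF \<nu>(1)] \<nu>(2) by (simp add: less_imp_le)
    qed
    then have "U \<in> null_open" unfolding null_open_def using Z U(1) by blast
    then show ?thesis unfolding N_def using U(2) by blast
  qed
  then have M_N: "moments g ` M_Trans T \<subseteq> N" by blast
  have "open U" if "U \<in> null_open" for U using that unfolding null_open_def by simp
  then obtain C where C: "C \<subseteq> null_open" "countable C" "\<Union>C = N"
    unfolding N_def by (rule Lindelof)
  have "\<forall>U\<in>C. \<exists>Z. Z \<in> null_sets m \<and> {z. \<exists>\<nu>\<in>limit_measures T z. moments g \<nu> \<in> U} \<subseteq> Z"
    using C(1) unfolding null_open_def by blast
  from bchoice[OF this] obtain Z where "\<forall>U\<in>C. Z U \<in> null_sets m \<and>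
      {z. \<exists>\<nu>\<in>limit_measures T z. moments g \<nu> \<in> U} \<subseteq> Z U" by (elim exE)
  then have Z: "\<And>U. U \<in> C \<Longrightarrow> Z U \<in> null_sets m"
    "\<And>U. U \<in> C \<Longrightarrow> {z. \<exists>\<nu>\<in>limit_measures T z. moments g \<nu> \<in> U} \<subseteq> Z U" by simp_all
  define Z0 where "Z0 = (\<Union>U\<in>C. Z U)"
  have Z0: "Z0 \<in> null_sets m" unfolding Z0_def using Z(1) C(2) by (intro null_sets_UN')
  have avoid: "moments g \<nu> \<notin> N" if "z \<notin> Z0" "\<nu> \<in> limit_measures T z" for z \<nu>
  proof
    assume "moments g \<nu> \<in> N"
    then obtain U where "U \<in> C" "moments g \<nu> \<in> U" using C(3) by blast
    then show False using Z(2) that unfolding Z0_def by blast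
  qed
  have "open N" unfolding N_def null_open_def by blast
  have typical: "\<exists>z\<in>U. \<exists>\<nu>\<in>limit_measures T z. moments g \<nu> \<in> - N" if "open U" "U \<noteq> {}" for U
  proof -
    have "\<not> U \<subseteq> Z0"
    proof
      assume "U \<subseteq> Z0"
      then have "emeasure m U \<le> emeasure m Z0" using Z0 by (intro emeasure_mono) auto
      then show False using m(2)[OF that] Z0 by auto
    qed
    then obtain z where "z \<in> U" "z \<notin> Z0" by blast
    then show ?thesis using avoid limit_measures_nonempty[of T z] by blast
  qed
  then have "- N \<noteq> {}" using open_UNIV by blast
  define W where "W j = {v. infdist v (- N) < inverse (real (Suc j))}" for j
  have W: "open (W j)" for j
    unfolding W_def by (intro open_Collect_less continuous_intros continuous_on_infdist)
  have "residual {x. \<exists>\<^sub>F n in sequentially. x \<in> {x. moments g (empirical T x n) \<in> W j}}" for j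
  proof (rule residual_frequently_open[OF compact_space open_vimage_moments_empirical[OF T W]])
    fix U :: "'a set" assume "open U" "U \<noteq> {}"
    then obtain z \<nu> where z: "z \<in> U" "\<nu> \<in> limit_measures T z" "moments g \<nu> \<in> - N" using typical by blast
    have "moments g \<nu> \<in> W j" unfolding W_def using z(3) by simp
    then show "\<exists>z\<in>U. \<exists>\<^sub>F n in sequentially. z \<in> {x. moments g (empirical T x n) \<in> W j}"
      using frequently_moments_empirical[OF z(2) W] z(1) by auto
  qed
  then have "residual ((\<Inter>j. {x. \<exists>\<^sub>F n in sequentially. x \<in> {x. moments g (empirical T x n) \<in> W j}}) \<inter>
      {x \<in> Trans T. limit_measures T x = M_Trans T})"
    by (intro residual_Int residual_INT compact_space residual_limit_measures_eq_M_Trans T tr)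
  from residual_nonempty[OF this] obtain x
    where "x \<in> (\<Inter>j. {x. \<exists>\<^sub>F n in sequentially. x \<in> {x. moments g (empirical T x n) \<in> W j}}) \<inter>
      {x \<in> Trans T. limit_measures T x = M_Trans T}" by blast
  then have x: "\<And>j. \<exists>\<^sub>F n in sequentially. moments g (empirical T x n) \<in> W j"
    "limit_measures T x = M_Trans T"
    by auto
  obtain s where s: "strict_mono s" "\<And>j. 0 < s j" "\<And>j. moments g (empirical T x (s j)) \<in> W j"
    using frequently_diagonal_subseq[of "\<lambda>j n. moments g (empirical T x n) \<in> W j", OF x(1)] by blast
  obtain r \<nu> where r: "strict_mono r" "\<nu> \<in> limit_measures T x"
    "\<And>f :: 'a \<Rightarrow>\<^sub>C real. (\<lambda>k. LINT y|empirical T x (s (r k)). f y) \<longlonglongrightarrow> (LINT y|\<nu>. f y)"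
    using limit_measures_compactness[OF s(1,2), of T x] by metis
  have "(\<lambda>k. moments g (empirical T x (s (r k)))) \<longlonglongrightarrow> moments g \<nu>"
    unfolding tendsto_fun_iff moments_def using r(3) by blast
  then have "(\<lambda>k. infdist (moments g (empirical T x (s (r k)))) (- N)) \<longlonglongrightarrow> infdist (moments g \<nu>) (- N)"
    by (rule tendsto_infdist)
  moreover have "(\<lambda>k. infdist (moments g (empirical T x (s (r k)))) (- N)) \<longlonglongrightarrow> 0"
  proof (rule tendsto_sandwich[where f = "\<lambda>_. 0" and h = "\<lambda>k. inverse (real (Suc (r k)))"])
    show "(\<lambda>k. inverse (real (Suc (r k)))) \<longlonglongrightarrow> 0"
      using LIMSEQ_subseq_LIMSEQ[OF LIMSEQ_inverse_real_of_nat r(1)] by (simp add: o_def)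
    show "\<forall>\<^sub>F k in sequentially. infdist (moments g (empirical T x (s (r k)))) (- N) \<le> inverse (real (Suc (r k)))"
      using s(3) unfolding W_def by (intro always_eventually) (simp add: less_imp_le del: of_nat_Suc)
  qed (simp_all add: infdist_nonneg)
  ultimately have "infdist (moments g \<nu>) (- N) = 0" by (rule LIMSEQ_unique)
  then have "moments g \<nu> \<in> - N"
    using in_closed_iff_infdist_zero[of "- N"] \<open>- N \<noteq> {}\<close> \<open>open N\<close> by (simp add: closed_Compl)
  then show False using M_N r(2) x(2) by blast
qed

end

text \<open>In a chart that meets \<open>U\<close> the image of \<open>U\<close> is a nonempty open set of Euclidean space, on which the
density is positive.\<close>

lemma lebesgue_on_manifold_pos_on_open:
  fixes \<A> :: "('a::topological_space set \<times> ('a \<Rightarrow> 'm::euclidean_space)) set"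
  assumes \<A>: "C1_atlas \<A>" and m: "lebesgue_on_manifold \<A> m" and U: "open U" "U \<noteq> {}"
  shows "0 < emeasure m U"
proof -
  obtain x where x: "x \<in> U" using U(2) by blast
  obtain V \<phi> where V: "(V, \<phi>) \<in> \<A>" "x \<in> V" using \<A> unfolding C1_atlas_def by blast
  have chart: "open V" "open (\<phi> ` V)" "homeomorphism V (\<phi> ` V) \<phi> (inv_into V \<phi>)"
    using bspec[OF conjunct1[OF \<A>[unfolded C1_atlas_def]] V(1)] by simp_all
  have "\<exists>w :: 'm \<Rightarrow> real. continuous_on (\<phi> ` V) w \<and> (\<forall>y\<in>\<phi> ` V. 0 < w y) \<and>
      (\<forall>B\<in>sets borel. B \<subseteq> V \<longrightarrow>
        emeasure m B = (\<integral>\<^sup>+y. ennreal (w y) * indicator (\<phi> ` B) y \<partial>lborel))"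
    using bspec[OF conjunct2[OF m[unfolded lebesgue_on_manifold_def]] V(1)] by simp
  then obtain w :: "'m \<Rightarrow> real" where w: "continuous_on (\<phi> ` V) w" "\<forall>y\<in>\<phi> ` V. 0 < w y"
    "\<forall>B\<in>sets borel. B \<subseteq> V \<longrightarrow>
      emeasure m B = (\<integral>\<^sup>+y. ennreal (w y) * indicator (\<phi> ` B) y \<partial>lborel)"
    by (elim exE conjE)
  let ?W = "\<phi> ` (U \<inter> V)"
  have "openin (top_of_set V) (U \<inter> V)" using openin_open_Int[OF U(1), of V] by (simp add: Int_commute)
  then have "openin (top_of_set (\<phi> ` V)) ?W" by (rule homeomorphism_imp_open_map[OF chart(3)])
  then have W: "open ?W" using chart(2) by (rule openin_open_trans)
  have WV: "?W \<subseteq> \<phi> ` V" by blast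
  have eq: "emeasure m (U \<inter> V) = (\<integral>\<^sup>+y. ennreal (w y) * indicator ?W y \<partial>lborel)"
    using w(3)[THEN bspec, of "U \<inter> V"] U(1) chart(1) by auto
  have meas: "(\<lambda>y. ennreal (w y) * indicator ?W y) \<in> borel_measurable lborel"
  proof -
    have "(\<lambda>y. indicator ?W y *\<^sub>R w y) \<in> borel_measurable borel"
      using W continuous_on_subset[OF w(1) WV] by (intro borel_measurable_continuous_on_indicator) auto
    then have "(\<lambda>y. ennreal (indicator ?W y *\<^sub>R w y)) \<in> borel_measurable borel" by measurable
    also have "(\<lambda>y. ennreal (indicator ?W y *\<^sub>R w y)) = (\<lambda>y. ennreal (w y) * indicator ?W y)"
      by (auto simp: indicator_def)
    finally show ?thesis by simp
  qed
  have "emeasure m (U \<inter> V) \<noteq> 0"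
  proof
    assume "emeasure m (U \<inter> V) = 0"
    then have "AE y in lborel. ennreal (w y) * indicator ?W y = 0"
      unfolding eq using nn_integral_0_iff_AE[OF meas] by simp
    then have "AE y in lborel. y \<notin> ?W"
    proof eventually_elim
      case (elim y)
      show ?case
      proof
        assume y: "y \<in> ?W"
        then have "0 < w y" using w(2) WV by blast
        then show False using elim y by (simp add: ennreal_eq_0_iff)
      qed
    qed
    then have "?W \<in> null_sets lborel"
      using AE_iff_null_sets[of ?W lborel] W by simp
    then have "negligible ?W"
      unfolding negligible_iff_null_sets by (rule null_sets_completionI)
    then show False using open_not_negligible[OF W] x V(2) by blast
  qed
  moreover have "emeasure m (U \<inter> V) \<le> emeasure m U"
    using m U(1) by (intro emeasure_mono) (auto simp: lebesgue_on_manifold_def)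
  ultimately show ?thesis by (metis le_zero_eq not_gr_zero)
qed

section \<open>Lyapunov-irregular points for a dense set of cocycles\<close>

lemma mat_norm_scaleR: "mat_norm (c *\<^sub>R A) = \<bar>c\<bar> * mat_norm A"
  for A :: "real^'d^'d"
  using onorm_scaleR[OF matrix_vector_mul_bounded_linear, of c A]
  by (simp add: scaleR_matrix_vector_assoc)

lemma cocycle_exp_scaleR:
  fixes A :: "'a \<Rightarrow> real^'d^'d"
  shows "cocycle T (\<lambda>x. exp (\<phi> x) *\<^sub>R A x) n x = exp (\<Sum>i<n. \<phi> ((T ^^ i) x)) *\<^sub>R cocycle T A n x"
  by (induction n) (simp_all add: scalar_matrix_assoc[symmetric] matrix_scalar_ac exp_add mult.commute)

lemma lyap_seq_exp_scaleR:
  fixes A :: "'a::topological_space \<Rightarrow> real^'d^'d" and \<phi> :: "'a \<Rightarrow>\<^sub>C real"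
  assumes A: "\<And>x. invertible (A x)"
  shows "lyap_seq T (\<lambda>x. exp (t * \<phi> x) *\<^sub>R A x) x n = t * (LINT y|empirical T x n. \<phi> y) + lyap_seq T A x n"
proof -
  have "0 < mat_norm (cocycle T A n x)" by (rule mat_norm_pos[OF invertible_cocycle[OF A]])
  then show ?thesis
    unfolding lyap_seq_def cocycle_exp_scaleR mat_norm_scaleR integral_empirical
    by (simp add: ln_mult_pos add_divide_distrib sum_distrib_left)
qed

lemma exp_scaleR_in_C_GL:
  fixes A :: "'a::topological_space \<Rightarrow> real^'d^'d" and \<phi> :: "'a \<Rightarrow>\<^sub>C real"
  assumes "A \<in> C_GL"
  shows "(\<lambda>x. exp (t * \<phi> x) *\<^sub>R A x) \<in> C_GL"
  using assms unfolding C_GL_def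
  by (auto intro!: continuous_intros scalar_invertible)

text \<open>The constant \<open>t\<close> comes from \<open>\<bar>1 - exp s\<bar> \<le> exp \<bar>s\<bar> - 1\<close> and a bound on the norms of \<open>A\<close>.\<close>

lemma exp_scaleR_close:
  fixes A :: "'a::metric_space \<Rightarrow> real^'d^'d" and \<phi> :: "'a \<Rightarrow>\<^sub>C real"
  assumes cpt: "compact (UNIV :: 'a set)" and A: "continuous_on UNIV A" and \<epsilon>: "0 < \<epsilon>"
  shows "\<exists>t>0. \<forall>x. mat_norm (A x - exp (t * \<phi> x) *\<^sub>R A x) \<le> \<epsilon>"
proof -
  have "compact (range (\<lambda>x. mat_norm (A x)))"
    by (intro compact_continuous_image continuous_on_mat_norm A cpt)
  then have "bdd_above (range (\<lambda>x. mat_norm (A x)))"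
    by (intro bounded_imp_bdd_above compact_imp_bounded)
  then obtain b where b: "\<And>x. mat_norm (A x) \<le> b" unfolding bdd_above_def by auto
  have "((\<lambda>t. (exp (t * norm \<phi>) - 1) * b) \<longlongrightarrow> (exp (0 * norm \<phi>) - 1) * b) (at_right 0)"
    by (intro tendsto_intros)
  then have "\<forall>\<^sub>F t in at_right 0. (exp (t * norm \<phi>) - 1) * b < \<epsilon>"
    using \<epsilon> by (intro order_tendstoD(2)) auto
  moreover have "\<forall>\<^sub>F t :: real in at_right 0. 0 < t" by (rule eventually_at_right_less)
  ultimately have "\<forall>\<^sub>F t in at_right 0. 0 < t \<and> (exp (t * norm \<phi>) - 1) * b < \<epsilon>"
    by eventually_elim simp
  then obtain t where t: "0 < t" "(exp (t * norm \<phi>) - 1) * b < \<epsilon>"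
    using eventually_happens' trivial_limit_at_right_real by blast
  have "mat_norm (A x - exp (t * \<phi> x) *\<^sub>R A x) \<le> \<epsilon>" for x
  proof -
    have exp_bound: "\<bar>1 - exp s\<bar> \<le> exp \<bar>s\<bar> - 1" for s :: real
    proof -
      have "2 \<le> exp s + exp (- s)"
        using exp_ge_add_one_self[of s] exp_ge_add_one_self[of "- s"] by linarith
      then show ?thesis by (cases "s \<ge> 0") (auto simp: abs_if)
    qed
    have "\<bar>t * \<phi> x\<bar> \<le> t * norm \<phi>"
      using norm_bounded[of \<phi> x] t(1) by (simp add: abs_mult)
    then have "\<bar>1 - exp (t * \<phi> x)\<bar> \<le> exp (t * norm \<phi>) - 1"
      using exp_bound[of "t * \<phi> x"] by (smt (verit) exp_le_cancel_iff)
    then have "\<bar>1 - exp (t * \<phi> x)\<bar> * mat_norm (A x) \<le> (exp (t * norm \<phi>) - 1) * b"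
      using b[of x] t(1) by (intro mult_mono) (auto simp: onorm_pos_le matrix_vector_mul_bounded_linear)
    moreover have "A x - exp (t * \<phi> x) *\<^sub>R A x = (1 - exp (t * \<phi> x)) *\<^sub>R A x"
      by (simp add: scaleR_left_diff_distrib)
    ultimately show ?thesis using t(2) by (simp add: mat_norm_scaleR)
  qed
  then show ?thesis using t(1) by blast
qed

text \<open>If the extremal exponents coincide, the exponent exists at every transitive point, but possibly as an
infinite value, at which the real sequence does not converge. An infinite common value would make
every transitive point irregular, so it is excluded as well.\<close>

lemma lyap_seq_tendsto_if_not_residual_LI:
  fixes T :: "'a::metric_space \<Rightarrow> 'a" and A :: "'a \<Rightarrow> real^'d^'d"
  assumes cpt: "compact (UNIV :: 'a set)" and T: "continuous_on UNIV T" and tr: "transitive_system T"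
    and A: "A \<in> C_GL" and nonres: "\<not> residual (LI T A)"
  shows "\<exists>L. \<forall>x\<in>Trans T. lyap_seq T A x \<longlonglongrightarrow> L"
proof -
  have eq: "lyap_inf T A = lyap_sup T A" using residual_LI[OF cpt T tr A] nonres by blast
  have lim: "(\<lambda>n. ereal (lyap_seq T A x n)) \<longlonglongrightarrow> lyap_sup T A" if "x \<in> Trans T" for x
  proof -
    have "lyap_inf T A \<le> lower_lyap T A x" "upper_lyap T A x \<le> lyap_sup T A"
      unfolding lyap_inf_def lyap_sup_def using that by (auto intro: INF_lower SUP_upper)
    moreover have "lower_lyap T A x \<le> upper_lyap T A x"
      unfolding lower_lyap_def upper_lyap_def by (rule Liminf_le_Limsup) simp
    ultimately have "lower_lyap T A x = lyap_sup T A" "upper_lyap T A x = lyap_sup T A"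
      using eq by auto
    then show ?thesis
      unfolding lower_lyap_def upper_lyap_def by (simp add: tendsto_iff_Liminf_eq_Limsup)
  qed
  have "\<not> Trans T \<subseteq> LI T A"
    using nonres residual_mono[OF residual_Trans[OF cpt T tr]] by blast
  then obtain y L where y: "y \<in> Trans T" "lyap_seq T A y \<longlonglongrightarrow> L"
    unfolding LI_def convergent_def by blast
  have "lyap_sup T A = ereal L"
    using LIMSEQ_unique[OF lim[OF y(1)]] y(2) by simp
  then show ?thesis using lim by auto
qed

context dense_tests
begin

text \<open>If the irregular set of \<open>A\<close> is not residual, then \<open>A\<close> has one finite exponent on all transitive
points, and the factor \<open>exp (t \<phi>)\<close> superposes the Birkhoff averages of \<open>\<phi>\<close>, which oscillate between
the integrals against \<open>\<mu>\<close> and \<open>\<nu>\<close> along the orbit of a generic point.\<close>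

lemma residual_LI_dense:
  fixes T :: "'a \<Rightarrow> 'a" and A :: "'a \<Rightarrow> real^'d^'d"
  assumes T: "continuous_on UNIV T" and tr: "transitive_system T"
    and \<mu>: "\<mu> \<in> M_Trans T" and \<nu>: "\<nu> \<in> M_Trans T" and neq: "\<mu> \<noteq> \<nu>"
    and A: "A \<in> C_GL" and \<epsilon>: "0 < \<epsilon>"
  shows "\<exists>B\<in>C_GL. residual (LI T B) \<and> (\<forall>x. mat_norm (A x - B x) \<le> \<epsilon>)"
proof (cases "residual (LI T A)")
  case True
  have "mat_norm (A x - A x) \<le> \<epsilon>" for x
    using \<epsilon> mat_norm_scaleR[of 0 "A x"] by simp
  then show ?thesis using True A by blast
next
  case False
  obtain L where L: "\<And>x. x \<in> Trans T \<Longrightarrow> lyap_seq T A x \<longlonglongrightarrow> L"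
    using lyap_seq_tendsto_if_not_residual_LI[OF compact_space T tr A False] by blast
  have "\<mu> \<in> prob_measures" "\<nu> \<in> prob_measures"
    using \<mu> \<nu> unfolding M_Trans_def limit_measures_def by blast+
  then obtain \<phi> :: "'a \<Rightarrow>\<^sub>C real" where \<phi>: "(LINT x|\<mu>. \<phi> x) \<noteq> (LINT x|\<nu>. \<phi> x)"
    using prob_measures_eqI[of \<mu> \<nu>] neq by blast
  obtain t where t: "0 < t" "\<forall>x. mat_norm (A x - exp (t * \<phi> x) *\<^sub>R A x) \<le> \<epsilon>"
    using exp_scaleR_close[OF compact_space _ \<epsilon>, of A \<phi>] A unfolding C_GL_def by blast
  define B where "B x = exp (t * \<phi> x) *\<^sub>R A x" for x
  have "x \<in> LI T B" if x: "x \<in> Trans T" "limit_measures T x = M_Trans T" for x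
  proof (rule ccontr)
    assume "x \<notin> LI T B"
    then obtain l where l: "lyap_seq T B x \<longlonglongrightarrow> l" unfolding LI_def convergent_def by blast
    have "(\<lambda>n. (lyap_seq T B x n - lyap_seq T A x n) / t) \<longlonglongrightarrow> (l - L) / t"
      using l L[OF x(1)] t(1) by (intro tendsto_intros) auto
    moreover have "(lyap_seq T B x n - lyap_seq T A x n) / t = (LINT y|empirical T x n. \<phi> y)" for n
      unfolding B_def using lyap_seq_exp_scaleR[of A T t \<phi> x n] A t(1) by (simp add: C_GL_def)
    ultimately have conv: "(\<lambda>n. LINT y|empirical T x n. \<phi> y) \<longlonglongrightarrow> (l - L) / t" by simp
    have "(LINT y|\<kappa>. \<phi> y) = (l - L) / t" if \<kappa>: "\<kappa> \<in> M_Trans T" for \<kappa>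
    proof -
      have "\<kappa> \<in> limit_measures T x" using \<kappa> x(2) by simp
      then obtain r where r: "strict_mono r"
        "\<And>f :: 'a \<Rightarrow>\<^sub>C real. (\<lambda>k. LINT y|empirical T x (r k). f y) \<longlonglongrightarrow> (LINT y|\<kappa>. f y)"
        using limit_measuresE[of \<kappa> T x] by metis
      show ?thesis
        using LIMSEQ_unique[OF r(2)[of \<phi>]] LIMSEQ_subseq_LIMSEQ[OF conv r(1)] by (simp add: o_def)
    qed
    then show False using \<phi> \<mu> \<nu> by simp
  qed
  then have "residual (LI T B)"
    by (intro residual_mono[OF residual_limit_measures_eq_M_Trans[OF T tr]]) blast
  moreover have "B \<in> C_GL" unfolding B_def by (rule exp_scaleR_in_C_GL[OF A])
  ultimately show ?thesis using t(2) unfolding B_def by blast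
qed

text \<open>The irregular sets of a countable family of cocycles still have a residual intersection, so the
approximating cocycles are restricted to a countable dense subset of those with residual irregular
set.\<close>

lemma countable_dense_residual_LI:
  fixes T :: "'a \<Rightarrow> 'a"
  assumes T: "continuous_on UNIV T" and tr: "transitive_system T"
    and \<mu>\<nu>: "\<mu> \<in> M_Trans T" "\<nu> \<in> M_Trans T" "\<mu> \<noteq> \<nu>"
  shows "\<exists>D :: ('a \<Rightarrow> real^'d^'d) set. countable D \<and> dense_in_C_GL D \<and> (\<forall>A\<in>D. residual (LI T A))"
proof -
  define R :: "('a \<Rightarrow> real^'d^'d) set" where "R = {A \<in> C_GL. residual (LI T A)}"
  have R: "continuous_on UNIV f" if "f \<in> R" for f using that unfolding R_def C_GL_def by blast
  obtain D where D: "countable D" "D \<subseteq> R"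
    "\<And>f e. f \<in> R \<Longrightarrow> 0 < e \<Longrightarrow> \<exists>g\<in>D. \<forall>x. dist (f x) (g x) < e"
    by (rule countable_uniformly_dense_subset[OF compact_space R], assumption, rule that)
  have "\<exists>C\<in>D. (SUP x. mat_norm (A x - C x)) < \<epsilon>" if A: "A \<in> C_GL" and \<epsilon>: "0 < \<epsilon>" for A \<epsilon>
  proof -
    have \<epsilon>3: "0 < \<epsilon> / 3" using \<epsilon> by simp
    obtain B where B: "B \<in> C_GL" "residual (LI T B)" "\<And>x. mat_norm (A x - B x) \<le> \<epsilon> / 3"
      using residual_LI_dense[OF T tr \<mu>\<nu> A \<epsilon>3] by blast
    define c where "c = real (CARD('d)) * real (CARD('d))"
    have c: "0 < c" unfolding c_def by simp
    have "B \<in> R" unfolding R_def using B by blast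
    then obtain C where C: "C \<in> D" "\<And>x. dist (B x) (C x) < \<epsilon> / 3 / c"
      using D(3)[of B "\<epsilon> / 3 / c"] \<epsilon>3 c by (metis divide_pos_pos)
    have "mat_norm (A x - C x) \<le> \<epsilon> / 3 + \<epsilon> / 3" for x
    proof -
      have "mat_norm (B x - C x) \<le> c * norm (B x - C x)" unfolding c_def by (rule mat_norm_le_norm)
      also have "\<dots> \<le> \<epsilon> / 3"
        using C(2)[of x] c by (simp add: dist_norm pos_less_divide_eq mult.commute)
      finally have "mat_norm (B x - C x) \<le> \<epsilon> / 3" .
      moreover have "mat_norm (A x - C x) \<le> mat_norm (A x - B x) + mat_norm (B x - C x)"
        using onorm_triangle[OF matrix_vector_mul_bounded_linear matrix_vector_mul_bounded_linear,
            of "A x - B x" "B x - C x"]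
        by (simp add: matrix_vector_mult_add_rdistrib[symmetric])
      ultimately show ?thesis using B(3)[of x] by linarith
    qed
    then have "(SUP x. mat_norm (A x - C x)) \<le> \<epsilon> / 3 + \<epsilon> / 3" by (intro cSUP_least) auto
    also have "\<dots> < \<epsilon>" using \<epsilon> by simp
    finally show ?thesis using C(1) by blast
  qed
  then have "dense_in_C_GL D" unfolding dense_in_C_GL_def using D(2) unfolding R_def by blast
  then show ?thesis using D(1,2) unfolding R_def by blast
qed

text \<open>The set of all good points is itself invariant: a point and its image have the same limit
measures and, up to a bounded error in the logarithms, the same exponents.\<close>

theorem residual_invariant_irregular_set:
  fixes T :: "'a \<Rightarrow> 'a"
  assumes T: "continuous_on UNIV T" and tr: "transitive_system T"
    and \<mu>\<nu>: "\<mu> \<in> M_Trans T" "\<nu> \<in> M_Trans T" "\<mu> \<noteq> \<nu>"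
  shows "\<exists>(Y :: 'a set) (\<U> :: ('a \<Rightarrow> real^'d^'d) set).
           residual Y \<and> T -` Y = Y \<and> dense_in_C_GL \<U> \<and>
           (\<forall>x\<in>Y. \<forall>A\<in>\<U>.
              (x \<in> Trans T \<and> limit_measures T x = M_Trans T) \<and>
              x \<in> LI T A \<and>
              (\<forall>(\<A> :: ('a set \<times> ('a \<Rightarrow> 'm::euclidean_space)) set) m F.
                 C1_atlas \<A> \<and> lebesgue_on_manifold \<A> m \<and> metrizing_family F \<longrightarrow>
                 limit_measures T x \<inter> physical_like T F m \<noteq> {}))"
proof -
  obtain D :: "('a \<Rightarrow> real^'d^'d) set" where D: "countable D" "dense_in_C_GL D"
    "\<And>A. A \<in> D \<Longrightarrow> residual (LI T A)"
    using countable_dense_residual_LI[OF T tr \<mu>\<nu>] by blast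
  define Y where "Y = {x \<in> Trans T. limit_measures T x = M_Trans T} \<inter> (\<Inter>A\<in>D. LI T A)"
  have res: "residual Y"
    unfolding Y_def
    by (intro residual_Int residual_INT_countable residual_limit_measures_eq_M_Trans compact_space T tr D)
  have inv: "T -` Y = Y"
  proof -
    have "T x \<in> Trans T \<longleftrightarrow> x \<in> Trans T" for x
      using Trans_backward Trans_forward[OF T tr] by blast
    moreover have "T x \<in> LI T A \<longleftrightarrow> x \<in> LI T A" if "A \<in> D" for x A
    proof -
      have "\<And>x. invertible (A x)" using that D(2) unfolding dense_in_C_GL_def C_GL_def by blast
      then show ?thesis using vimage_LI[of A T] by blast
    qed
    ultimately show ?thesis unfolding Y_def by (auto simp: limit_measures_shift)
  qed
  have phys: "limit_measures T x \<inter> physical_like T F m \<noteq> {}"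
    if "x \<in> Y" "C1_atlas \<A>" "lebesgue_on_manifold \<A> m" "metrizing_family F"
    for x and \<A> :: "('a set \<times> ('a \<Rightarrow> 'm)) set" and m F
  proof -
    have "M_Trans T \<inter> physical_like T F m \<noteq> {}"
    proof (rule M_Trans_meets_physical_like[OF T tr])
      show "norm (F i) \<le> 1" for i using that(4) unfolding metrizing_family_def by simp
      show "sets m = sets borel" using that(3) unfolding lebesgue_on_manifold_def by simp
      show "0 < emeasure m U" if "open U" "U \<noteq> {}" for U
        using lebesgue_on_manifold_pos_on_open that \<open>C1_atlas \<A>\<close> \<open>lebesgue_on_manifold \<A> m\<close> by blast
    qed
    then show ?thesis using that(1) unfolding Y_def by simp
  qed
  show ?thesis
  proof (intro exI[of _ Y] exI[of _ D] conjI ballI allI impI)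
    fix x and A :: "'a \<Rightarrow> real^'d^'d" assume x: "x \<in> Y" and A: "A \<in> D"
    show "x \<in> Trans T" "limit_measures T x = M_Trans T" "x \<in> LI T A"
      using x A unfolding Y_def by auto
    show "limit_measures T x \<inter> physical_like T F m \<noteq> {}"
      if "C1_atlas \<A> \<and> lebesgue_on_manifold \<A> m \<and> metrizing_family F"
      for \<A> :: "('a set \<times> ('a \<Rightarrow> 'm)) set" and m F
      using phys[OF x] that by blast
  qed (rule res inv D)+
qed

end

section \<open>Generic behaviour in a transitive system\<close>

theorem theorem3:
  fixes T :: "'a::metric_space \<Rightarrow> 'a"
  assumes "compact (UNIV :: 'a set)"
    and "continuous_on UNIV T"
    and "transitive_system T"
  shows
    "(\<forall>f :: nat \<Rightarrow> 'a \<Rightarrow>\<^sub>C real. subadditive_seq T f \<longrightarrow>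
        residual {x \<in> Trans T. growth f x = growth_sup T f})
     \<and>
     (\<forall>A :: 'a \<Rightarrow> real^'d^'d. A \<in> C_GL \<longrightarrow>
        residual {x \<in> Trans T. upper_lyap T A x = lyap_sup T A} \<and>
        residual {x \<in> Trans T. lower_lyap T A x = lyap_inf T A} \<and>
        (lyap_inf T A = lyap_sup T A \<or> residual (LI T A)))
     \<and>
     ((\<exists>\<mu>\<in>M_Trans T. \<exists>\<nu>\<in>M_Trans T. \<mu> \<noteq> \<nu>) \<longrightarrow>
        (\<exists>(Y :: 'a set) (\<U> :: ('a \<Rightarrow> real^'d^'d) set).
           residual Y \<and> T -` Y = Y \<and> dense_in_C_GL \<U> \<and>
           (\<forall>x\<in>Y. \<forall>A\<in>\<U>.
              (x \<in> Trans T \<and> limit_measures T x = M_Trans T) \<and>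
              x \<in> LI T A \<and>
              (\<forall>(\<A> :: ('a set \<times> ('a \<Rightarrow> 'm::euclidean_space)) set) m F.
                 C1_atlas \<A> \<and> lebesgue_on_manifold \<A> m \<and> metrizing_family F \<longrightarrow>
                 limit_measures T x \<inter> physical_like T F m \<noteq> {}))))"
proof (intro conjI allI impI)
  note sys = assms
  show "residual {x \<in> Trans T. growth f x = growth_sup T f}" if "subadditive_seq T f"
    for f :: "nat \<Rightarrow> 'a \<Rightarrow>\<^sub>C real"
    by (rule residual_growth_eq_sup[OF sys that])
  show "residual {x \<in> Trans T. upper_lyap T A x = lyap_sup T A}"
    "residual {x \<in> Trans T. lower_lyap T A x = lyap_inf T A}"
    "lyap_inf T A = lyap_sup T A \<or> residual (LI T A)"
    if A: "A \<in> C_GL" for A :: "'a \<Rightarrow> real^'d^'d"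
    using residual_upper_lyap_eq_sup[OF sys A] residual_lower_lyap_eq_inf[OF sys A] residual_LI[OF sys A]
    by blast+
next
  assume "\<exists>\<mu>\<in>M_Trans T. \<exists>\<nu>\<in>M_Trans T. \<mu> \<noteq> \<nu>"
  then obtain \<mu> \<nu> where \<mu>\<nu>: "\<mu> \<in> M_Trans T" "\<nu> \<in> M_Trans T" "\<mu> \<noteq> \<nu>" by blast
  obtain g :: "nat \<Rightarrow> 'a \<Rightarrow>\<^sub>C real" where
    g: "\<And>(f :: 'a \<Rightarrow>\<^sub>C real) e. 0 < e \<Longrightarrow> \<exists>i. \<forall>x. dist (f x) (g i x) < e"
    by (rule bounded_continuous_dense_sequence[OF assms(1)], rule that)
  have "dense_tests g" by (rule dense_tests.intro[OF assms(1)]) (rule g)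
  from dense_tests.residual_invariant_irregular_set[OF this assms(2,3) \<mu>\<nu>]
  show "\<exists>(Y :: 'a set) (\<U> :: ('a \<Rightarrow> real^'d^'d) set).
           residual Y \<and> T -` Y = Y \<and> dense_in_C_GL \<U> \<and>
           (\<forall>x\<in>Y. \<forall>A\<in>\<U>.
              (x \<in> Trans T \<and> limit_measures T x = M_Trans T) \<and>
              x \<in> LI T A \<and>
              (\<forall>(\<A> :: ('a set \<times> ('a \<Rightarrow> 'm::euclidean_space)) set) m F.
                 C1_atlas \<A> \<and> lebesgue_on_manifold \<A> m \<and> metrizing_family F \<longrightarrow>
                 limit_measures T x \<inter> physical_like T F m \<noteq> {}))" .
qed

end
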